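(* Let $\mathfrak{L}_\pm$ be dual definite subspaces of the Krein space $(\mathfrak{H},[\cdot,\cdot])$, let $T_0$ be the operator associated with $\mathfrak{L}_\pm$, and let $T_\mu$, $T_M$ be the hard and the soft extensions of $T_0$. A self-adjoint contractive extension $T\supset T_0$ determines dual maximal subspaces $\mathfrak{L}_\pm^{max}$ by the formula $\mathfrak{L}_\pm^{max}=(I+T)\mathfrak{H}_\pm$ if and only if the corresponding nonnegative self-adjoint contraction $X$ in $\mathfrak{M}=\overline{R(T_M-T_\mu)}$ describing $T$ by $$T=T_\mu+(T_M-T_\mu)^{1/2}X(T_M-T_\mu)^{1/2}$$ is a solution of the following operator equation in $\mathfrak{M}$: $$X=J(I-X)J.$$
   Context: $\mathfrak{H}$ is a complex Hilbert space with inner product $(\cdot,\cdot)$ (linear in the first argument), $J$ is an operator with $J=J^*$, $J^2=I$, $J\neq\pm I$, and $[f,g]=(Jf,g)$; $(\mathfrak{H},[\cdot,\cdot])$ is the Krein space. Put $P_\pm=\frac12(I\pm J)$, $\mathfrak{H}_\pm=P_\pm\mathfrak{H}$. Subspaces are closed. A subspace $\mathfrak{L}$ is positive (negative) if $[f,f]>0$ ($[f,f]<0$) for all nonzero $f\in\mathfrak{L}$; it is maximal positive (maximal negative) if it is not a proper subspace of another positive (negative) subspace. Subspaces $\mathfrak{L}_\pm$ are dual definite if $\mathfrak{L}_+$ is positive, $\mathfrak{L}_-$ is negative, and $[f_+,f_-]=0$ for all $f_\pm\in\mathfrak{L}_\pm$. The notation $\mathfrak{L}_\pm^{max}$ (dual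 maximal subspaces) refers to dual definite subspaces such that $\mathfrak{L}_+^{max}$ is maximal positive and $\mathfrak{L}_-^{max}$ is maximal negative. Associated operator: $\mathfrak{L}_\pm$ can be written uniquely as $\mathfrak{L}_+=\{x_++K_+^-x_+:x_+\in M_+\}$, $\mathfrak{L}_-=\{x_-+K_-^+x_-:x_-\in M_-\}$, with $M_\pm$ closed subspaces of $\mathfrak{H}_\pm$ and $K_+^-:M_+\to\mathfrak{H}_-$, $K_-^+:M_-\to\mathfrak{H}_+$ strong contractions ($\|Kf\|<\|f\|$ for $f\ne0$). The operator associated with $\mathfrak{L}_\pm$ is $T_0=K_+^-P_++K_-^+P_-$ with $D(T_0)=M_+\oplus M_-$, so that $\mathfrak{L}_\pm=(I+T_0)M_\pm$. For dual definite $\mathfrak{L}_\pm$, $T_0$ is a symmetric strong contraction (in general not densely defined) with $JT_0=-T_0J$. The set of all self-adjoint contractive extensions of $T_0$ (defined on all of $\mathfrak{H}$) is an operator interval $[T_\mu,T_M]$; its end points $T_\mu$ and $T_M$ are called the hard and the soft extensions. The displayed formula for $T$ gives a one-to-one correspondence between all self-adjoint contractive extensions $T$ of $T_0$ and all nonnegative self-adjoint contractions $X$ in $\mathfrak{M}$, where $R(\cdot)$ denotes the range. The subspace $\mathfrak{M}$ reduces $J$, and $J$ in the equation denotes the restriction of $J$ to $\mathfrak{M}$.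
   Formalization: As stated the claim fails. Proved: the equivalence when L_+ + L_- is dense in H; and for arbitrary L_±, "determines" includes that T is the operator associated with (I+T)H_±, and this holds iff X=J(I-X)J and T is a strong contraction. *)

theory Defs
  imports "HOL-Analysis.Analysis"
begin

text \<open>Complex Hilbert spaces; the inner product is linear in the \<^emph>\<open>first\<close> argument.\<close>

class complex_inner = real_normed_vector +
  fixes scaleC :: "complex \<Rightarrow> 'a \<Rightarrow> 'a"  (infixr "*\<^sub>C" 75)
    and cinner :: "'a \<Rightarrow> 'a \<Rightarrow> complex"
  assumes scaleC_add_right: "c *\<^sub>C (x + y) = c *\<^sub>C x + c *\<^sub>C y"
    and scaleC_add_left: "(c + d) *\<^sub>C x = c *\<^sub>C x + d *\<^sub>C x"
    and scaleC_scaleC: "c *\<^sub>C (d *\<^sub>C x) = (c * d) *\<^sub>C x"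
    and scaleC_of_real: "complex_of_real r *\<^sub>C x = r *\<^sub>R x"
    and cinner_commute: "cinner x y = cnj (cinner y x)"
    and cinner_add_left: "cinner (x + y) z = cinner x z + cinner y z"
    and cinner_scaleC_left: "cinner (c *\<^sub>C x) y = c * cinner x y"
    and cinner_self: "cinner x x = complex_of_real ((norm x)\<^sup>2)"

class chilbert_space = complex_inner + complete_space

global_interpretation complex_vector:
  vector_space "scaleC :: complex \<Rightarrow> 'a \<Rightarrow> 'a::complex_inner"
proof
  fix x :: 'a
  show "1 *\<^sub>C x = x" using scaleC_of_real[of 1 x] by simp
qed (simp_all add: scaleC_add_right scaleC_add_left scaleC_scaleC)

text \<open>Operators on all of the space are functions. An operator in a subspace \<open>M\<close> is a
  function of which only the values on \<open>M\<close> matter.\<close>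

definition closed_csubspace :: "'a::complex_inner set \<Rightarrow> bool" where
  "closed_csubspace L \<longleftrightarrow> complex_vector.subspace L \<and> closed L"

definition clinear_on :: "'a::complex_inner set \<Rightarrow> ('a \<Rightarrow> 'a) \<Rightarrow> bool" where
  "clinear_on M K \<longleftrightarrow>
     (\<forall>f\<in>M. \<forall>g\<in>M. K (f + g) = K f + K g) \<and> (\<forall>c. \<forall>f\<in>M. K (c *\<^sub>C f) = c *\<^sub>C K f)"

definition selfadjoint :: "('a::complex_inner \<Rightarrow> 'a) \<Rightarrow> bool" where
  "selfadjoint T \<longleftrightarrow>
     clinear_on UNIV T \<and> bounded_linear T \<and> (\<forall>f g. cinner (T f) g = cinner f (T g))"

definition contraction :: "('a::complex_inner \<Rightarrow> 'a) \<Rightarrow> bool" where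
  "contraction T \<longleftrightarrow> (\<forall>f. norm (T f) \<le> norm f)"

definition strong_contraction_on :: "'a::complex_inner set \<Rightarrow> ('a \<Rightarrow> 'a) \<Rightarrow> bool" where
  "strong_contraction_on M K \<longleftrightarrow> (\<forall>f\<in>M. f \<noteq> 0 \<longrightarrow> norm (K f) < norm f)"

text \<open>The quadratic forms of self-adjoint operators are real, so \<open>Re\<close> loses nothing
  below. The same remark applies to \<open>Re [f,f]\<close>.\<close>

definition op_le :: "('a::complex_inner \<Rightarrow> 'a) \<Rightarrow> ('a \<Rightarrow> 'a) \<Rightarrow> bool" where
  "op_le A B \<longleftrightarrow> (\<forall>f. Re (cinner (A f) f) \<le> Re (cinner (B f) f))"

definition op_sqrt :: "('a::complex_inner \<Rightarrow> 'a) \<Rightarrow> 'a \<Rightarrow> 'a" where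
  "op_sqrt A = (THE S. selfadjoint S \<and> op_le (\<lambda>_. 0) S \<and> S \<circ> S = A)"

definition nonneg_selfadjoint_contraction_in ::
    "'a::complex_inner set \<Rightarrow> ('a \<Rightarrow> 'a) \<Rightarrow> bool" where
  "nonneg_selfadjoint_contraction_in M X \<longleftrightarrow>
     X ` M \<subseteq> M \<and> clinear_on M X \<and>
     (\<forall>f\<in>M. \<forall>g\<in>M. cinner (X f) g = cinner f (X g)) \<and>
     (\<forall>f\<in>M. 0 \<le> Re (cinner (X f) f)) \<and>
     (\<forall>f\<in>M. norm (X f) \<le> norm f)"

definition fundamental_symmetry :: "('a::complex_inner \<Rightarrow> 'a) \<Rightarrow> bool" where
  "fundamental_symmetry J \<longleftrightarrow>
     selfadjoint J \<and> (\<forall>f. J (J f) = f) \<and> J \<noteq> (\<lambda>f. f) \<and> J \<noteq> (\<lambda>f. - f)"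

definition krein :: "('a::complex_inner \<Rightarrow> 'a) \<Rightarrow> 'a \<Rightarrow> 'a \<Rightarrow> complex" where
  "krein J f g = cinner (J f) g"

definition P_plus :: "('a::complex_inner \<Rightarrow> 'a) \<Rightarrow> 'a \<Rightarrow> 'a" where
  "P_plus J f = (1/2) *\<^sub>R (f + J f)"

definition P_minus :: "('a::complex_inner \<Rightarrow> 'a) \<Rightarrow> 'a \<Rightarrow> 'a" where
  "P_minus J f = (1/2) *\<^sub>R (f - J f)"

definition H_plus :: "('a::complex_inner \<Rightarrow> 'a) \<Rightarrow> 'a set" where
  "H_plus J = range (P_plus J)"

definition H_minus :: "('a::complex_inner \<Rightarrow> 'a) \<Rightarrow> 'a set" where
  "H_minus J = range (P_minus J)"

definition positive_subspace :: "('a::complex_inner \<Rightarrow> 'a) \<Rightarrow> 'a set \<Rightarrow> bool" where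
  "positive_subspace J L \<longleftrightarrow>
     closed_csubspace L \<and> (\<forall>f\<in>L. f \<noteq> 0 \<longrightarrow> Re (krein J f f) > 0)"

definition negative_subspace :: "('a::complex_inner \<Rightarrow> 'a) \<Rightarrow> 'a set \<Rightarrow> bool" where
  "negative_subspace J L \<longleftrightarrow>
     closed_csubspace L \<and> (\<forall>f\<in>L. f \<noteq> 0 \<longrightarrow> Re (krein J f f) < 0)"

definition maximal_positive :: "('a::complex_inner \<Rightarrow> 'a) \<Rightarrow> 'a set \<Rightarrow> bool" where
  "maximal_positive J L \<longleftrightarrow>
     positive_subspace J L \<and> \<not> (\<exists>L'. positive_subspace J L' \<and> L \<subset> L')"

definition maximal_negative :: "('a::complex_inner \<Rightarrow> 'a) \<Rightarrow> 'a set \<Rightarrow> bool" where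
  "maximal_negative J L \<longleftrightarrow>
     negative_subspace J L \<and> \<not> (\<exists>L'. negative_subspace J L' \<and> L \<subset> L')"

definition dual_definite :: "('a::complex_inner \<Rightarrow> 'a) \<Rightarrow> 'a set \<Rightarrow> 'a set \<Rightarrow> bool" where
  "dual_definite J Lp Lm \<longleftrightarrow>
     positive_subspace J Lp \<and> negative_subspace J Lm \<and>
     (\<forall>f\<in>Lp. \<forall>g\<in>Lm. krein J f g = 0)"

definition dual_maximal :: "('a::complex_inner \<Rightarrow> 'a) \<Rightarrow> 'a set \<Rightarrow> 'a set \<Rightarrow> bool" where
  "dual_maximal J Lp Lm \<longleftrightarrow>
     dual_definite J Lp Lm \<and> maximal_positive J Lp \<and> maximal_negative J Lm"

text \<open>\<open>L = {x + K x : x \<in> M}\<close> with \<open>K : M \<rightarrow> H2\<close> a strong contraction on a closed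
  subspace \<open>M\<close> of \<open>H1\<close>.\<close>

definition graph_representation ::
    "'a::complex_inner set \<Rightarrow> 'a set \<Rightarrow> 'a set \<Rightarrow> 'a set \<Rightarrow> ('a \<Rightarrow> 'a) \<Rightarrow> bool" where
  "graph_representation H1 H2 L M K \<longleftrightarrow>
     closed_csubspace M \<and> M \<subseteq> H1 \<and> clinear_on M K \<and> K ` M \<subseteq> H2 \<and>
     strong_contraction_on M K \<and> L = (\<lambda>x. x + K x) ` M"

text \<open>\<open>T0\<close>, with domain \<open>D\<close>, is the operator associated with \<open>Lp\<close>, \<open>Lm\<close>; the
  values of the function \<open>T0\<close> outside \<open>D\<close> are unconstrained.\<close>

definition associated_operator ::
    "('a::complex_inner \<Rightarrow> 'a) \<Rightarrow> 'a set \<Rightarrow> 'a set \<Rightarrow> 'a set \<Rightarrow> ('a \<Rightarrow> 'a) \<Rightarrow> bool" where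
  "associated_operator J Lp Lm D T0 \<longleftrightarrow>
     (\<exists>Mp Mm Kp Km.
        graph_representation (H_plus J) (H_minus J) Lp Mp Kp \<and>
        graph_representation (H_minus J) (H_plus J) Lm Mm Km \<and>
        D = {x + y | x y. x \<in> Mp \<and> y \<in> Mm} \<and>
        (\<forall>f\<in>D. T0 f = Kp (P_plus J f) + Km (P_minus J f)))"

definition selfadjoint_contractive_extension ::
    "'a::complex_inner set \<Rightarrow> ('a \<Rightarrow> 'a) \<Rightarrow> ('a \<Rightarrow> 'a) \<Rightarrow> bool" where
  "selfadjoint_contractive_extension D T0 T \<longleftrightarrow>
     selfadjoint T \<and> contraction T \<and> (\<forall>f\<in>D. T f = T0 f)"

text \<open>The end points of the operator interval formed by all self-adjoint contractive
  extensions: its least (hard) and greatest (soft) element.\<close>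

definition hard_extension ::
    "'a::complex_inner set \<Rightarrow> ('a \<Rightarrow> 'a) \<Rightarrow> ('a \<Rightarrow> 'a) \<Rightarrow> bool" where
  "hard_extension D T0 Tmu \<longleftrightarrow>
     selfadjoint_contractive_extension D T0 Tmu \<and>
     (\<forall>T. selfadjoint_contractive_extension D T0 T \<longrightarrow> op_le Tmu T)"

definition soft_extension ::
    "'a::complex_inner set \<Rightarrow> ('a \<Rightarrow> 'a) \<Rightarrow> ('a \<Rightarrow> 'a) \<Rightarrow> bool" where
  "soft_extension D T0 TM \<longleftrightarrow>
     selfadjoint_contractive_extension D T0 TM \<and>
     (\<forall>T. selfadjoint_contractive_extension D T0 T \<longrightarrow> op_le T TM)"

end

theory Submission
  imports Defs
begin

text \<open>Everything turns on the anticommutation \<open>J T = -T J\<close>, which is to say that \<open>T\<close>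
  interchanges \<open>H\<^sub>+\<close> and \<open>H\<^sub>-\<close>. It links the two sides of the equivalence.

  On the side of the operator equation: \<open>T\<^sub>0\<close> anticommutes with \<open>J\<close>, so \<open>T \<mapsto> -J T J\<close> is an
  order-reversing involution of the operator interval \<open>[T\<^sub>\<mu>, T\<^sub>M]\<close> and interchanges its end
  points: \<open>T\<^sub>M = -J T\<^sub>\<mu> J\<close>. Hence \<open>A = T\<^sub>M - T\<^sub>\<mu>\<close> commutes with \<open>J\<close>, and so does its positive
  square root \<open>S\<close>, by uniqueness. With \<open>T = T\<^sub>\<mu> + S X S\<close> this gives
  \<open>T + J T J = S (X - I + J X J) S\<close>, and since the range of \<open>A = S\<^sup>2\<close> is dense in \<open>M\<close> the right-hand
  side vanishes if and only if \<open>X = J (I - X) J\<close> on \<open>M\<close> (\<open>anticommutes_iff_operator_equation\<close>).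

  On the side of the subspaces: if \<open>T\<close> anticommutes with \<open>J\<close>, then the spaces \<open>(I + T) H\<^sub>\<plusminus>\<close> are
  the graphs of the restrictions of \<open>T\<close> to \<open>H\<^sub>\<plusminus>\<close>. Such graphs are dual, and they are maximal
  definite as soon as the restrictions are strong contractions (\<open>graph_dual_maximal\<close>). If \<open>L\<^sub>+ + L\<^sub>-\<close>
  is dense, so is the range of \<open>I + T\<close>, and then strong contractivity is automatic
  (\<open>anticommutes_strong_contraction\<close>). Conversely, under the same density, duality of
  \<open>(I + T) H\<^sub>\<plusminus>\<close> alone forces anticommutation (\<open>dual_graphs_anticommute\<close>). Without density the
  example \<open>T = P\<^sub>+ / 2\<close>, for which \<open>(I + T) H\<^sub>\<plusminus> = H\<^sub>\<plusminus>\<close>, shows that \<open>T\<close> is not determined by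
  these subspaces; the second equivalence therefore requires \<open>T\<close> to be their associated operator,
  which contains both anticommutation and strong contractivity.

  The square root is built from scratch: \<open>I - (I - B)\<^sup>1\<^sup>/\<^sup>2\<close> is the limit of polynomials in the
  contraction \<open>B\<close> whose increments have nonnegative coefficients.\<close>

section \<open>Inner products and symmetric operators\<close>

lemma cinner_add_right: "cinner x (y + z) = cinner x y + cinner x z"
  by (metis cinner_add_left cinner_commute complex_cnj_add)

lemma cinner_scaleC_right: "cinner x (c *\<^sub>C y) = cnj c * cinner x y"
  by (metis cinner_scaleC_left cinner_commute complex_cnj_mult)

lemma cinner_scaleR_left: "cinner (r *\<^sub>R x) y = r *\<^sub>R cinner x y"
  by (metis cinner_scaleC_left scaleC_of_real scaleR_conv_of_real)

lemma cinner_scaleR_right: "cinner x (r *\<^sub>R y) = r *\<^sub>R cinner x y"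
  by (metis cinner_scaleC_right scaleC_of_real scaleR_conv_of_real complex_cnj_complex_of_real)

lemma Re_cinner_commute: "Re (cinner x y) = Re (cinner y x)"
  by (subst cinner_commute) simp

lemma Re_cinner_self: "Re (cinner x x) = (norm x)\<^sup>2"
  by (simp add: cinner_self)

lemma norm_cinner_le: "norm (cinner x y) \<le> norm x * norm y"
proof (cases "y = 0")
  case True
  then show ?thesis using cinner_scaleR_right[of x 0 y] by simp
next
  case False
  define c where "c = cinner x y / (norm y)\<^sup>2"
  have ny: "(norm y)\<^sup>2 > 0" using False by simp
  have cy: "c * (norm y)\<^sup>2 = cinner x y"
    using ny by (simp add: c_def)
  have "cinner (x + d *\<^sub>C y) (x + d *\<^sub>C y)
      = cinner x x + cnj d * cinner x y + d * cinner y x + d * cnj d * (norm y)\<^sup>2" for d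
    by (simp add: cinner_add_left cinner_add_right cinner_scaleC_left cinner_scaleC_right
        cinner_self[of y] algebra_simps)
  from this[of "- c"] have "cinner (x + (- c) *\<^sub>C y) (x + (- c) *\<^sub>C y)
      = cinner x x - cnj c * cinner x y - c * cinner y x + c * cnj c * (norm y)\<^sup>2"
    by simp
  also have "\<dots> = cinner x x - c * cinner y x"
    using cy by (simp add: algebra_simps)
  also have "c * cinner y x = of_real ((norm (cinner x y))\<^sup>2 / (norm y)\<^sup>2)"
    by (subst cinner_commute) (simp add: c_def complex_norm_square[symmetric])
  finally have "(norm (x + (- c) *\<^sub>C y))\<^sup>2 = (norm x)\<^sup>2 - (norm (cinner x y))\<^sup>2 / (norm y)\<^sup>2"
    unfolding cinner_self of_real_diff[symmetric] of_real_eq_iff .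
  then have "(norm (cinner x y))\<^sup>2 / (norm y)\<^sup>2 \<le> (norm x)\<^sup>2"
    by (metis diff_ge_0_iff_ge zero_le_power2)
  then have "(norm (cinner x y))\<^sup>2 \<le> (norm x * norm y)\<^sup>2"
    using ny by (simp add: field_simps power_mult_distrib)
  then show ?thesis by (rule power2_le_imp_le) simp
qed

interpretation cinner: bounded_bilinear "cinner :: 'a::complex_inner \<Rightarrow> 'a \<Rightarrow> complex"
  by (rule bounded_bilinear.intro)
    (auto simp: cinner_add_left cinner_add_right cinner_scaleR_left cinner_scaleR_right
      intro!: exI[of _ 1] norm_cinner_le)

lemma norm_add_square:
  fixes x y :: "'a::complex_inner"
  shows "(norm (x + y))\<^sup>2 = (norm x)\<^sup>2 + 2 * Re (cinner x y) + (norm y)\<^sup>2"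
  using Re_cinner_commute[of y x]
  by (simp add: Re_cinner_self[symmetric] cinner_add_left cinner_add_right)

lemma norm_diff_square:
  fixes x y :: "'a::complex_inner"
  shows "(norm (x - y))\<^sup>2 = (norm x)\<^sup>2 - 2 * Re (cinner x y) + (norm y)\<^sup>2"
  using norm_add_square[of x "- y"] by (simp add: cinner.minus_right)

lemma cinner_eqI: "f = g" if "\<And>h. cinner f h = cinner g h"
  for f g :: "'a::complex_inner"
proof -
  have "cinner (f - g) (f - g) = 0"
    using that by (simp only: cinner.diff_left) simp
  then show ?thesis by (simp add: cinner_self)
qed

lemma orthogonal_closure_eq_0:
  fixes u :: "'a::complex_inner"
  assumes "u \<in> closure S" and "\<And>v. v \<in> S \<Longrightarrow> cinner u v = 0"
  shows "u = 0"
proof -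
  have "closed {v. cinner u v = 0}"
    by (intro closed_Collect_eq cinner.continuous_on continuous_on_const continuous_on_id)
  then have "closure S \<subseteq> {v. cinner u v = 0}"
    using assms(2) by (intro closure_minimal) auto
  then show ?thesis using assms(1) by (auto simp: cinner_self)
qed

text \<open>Symmetry alone forces linearity, because \<open>T (f + g) - T f - T g\<close> is orthogonal to every
  vector.\<close>

lemma selfadjointI:
  fixes T :: "'a::complex_inner \<Rightarrow> 'a"
  assumes sym: "\<And>f g. cinner (T f) g = cinner f (T g)"
    and bd: "\<And>f. norm (T f) \<le> c * norm f"
  shows "selfadjoint T"
proof -
  have add: "T (f + g) = T f + T g" for f g
    by (rule cinner_eqI) (simp add: sym cinner_add_left)
  have sc: "T (a *\<^sub>C f) = a *\<^sub>C T f" for a f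
    by (rule cinner_eqI) (simp add: sym cinner_scaleC_left)
  have "bounded_linear T"
    by (rule bounded_linear_intro[of _ c])
      (use add sc scaleC_of_real bd in \<open>metis mult.commute\<close>)+
  then show ?thesis using add sc sym by (auto simp: selfadjoint_def clinear_on_def)
qed

lemma selfadjoint_bounded_linear: "selfadjoint T \<Longrightarrow> bounded_linear T"
  by (simp add: selfadjoint_def)

lemma selfadjoint_sym: "selfadjoint T \<Longrightarrow> cinner (T f) g = cinner f (T g)"
  by (simp add: selfadjoint_def)

lemma selfadjoint_linear:
  assumes "selfadjoint T"
  shows "T (f + g) = T f + T g" "T (f - g) = T f - T g" "T (- f) = - T f" "T 0 = 0"
    "T (r *\<^sub>R f) = r *\<^sub>R T f" "T (c *\<^sub>C f) = c *\<^sub>C T f"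
proof -
  interpret bounded_linear T using assms by (rule selfadjoint_bounded_linear)
  show "T (f + g) = T f + T g" "T (f - g) = T f - T g" "T (- f) = - T f" "T 0 = 0"
    "T (r *\<^sub>R f) = r *\<^sub>R T f" by (rule add diff neg zero scaleR)+
  show "T (c *\<^sub>C f) = c *\<^sub>C T f" using assms by (simp add: selfadjoint_def clinear_on_def)
qed

lemma selfadjoint_diff:
  assumes A: "selfadjoint A" and B: "selfadjoint B"
  shows "selfadjoint (\<lambda>f. A f - B f)"
proof -
  obtain a where a: "\<And>f. norm (A f) \<le> norm f * a"
    using bounded_linear.bounded[OF selfadjoint_bounded_linear[OF A]] by blast
  obtain b where b: "\<And>f. norm (B f) \<le> norm f * b"
    using bounded_linear.bounded[OF selfadjoint_bounded_linear[OF B]] by blast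
  have "norm (A f - B f) \<le> (a + b) * norm f" for f
    using norm_triangle_ineq4[of "A f" "B f"] a[of f] b[of f] by (simp add: algebra_simps)
  then show ?thesis
    by (intro selfadjointI[of _ "a + b"])
      (auto simp: cinner.diff_left cinner.diff_right selfadjoint_sym[OF A] selfadjoint_sym[OF B])
qed

text \<open>The form of a positive operator is nonnegative at \<open>f - C f / c\<close>. This quantitative version
  of the Cauchy-Schwarz inequality for that form serves two ends: it makes \<open>I - C / c\<close> a
  contraction, and it shows that \<open>C f\<close> vanishes with the form.\<close>

lemma positive_operator_bound:
  assumes C: "selfadjoint C" and pos: "op_le (\<lambda>_. 0) C"
    and c: "c > 0" and bd: "\<And>f. norm (C f) \<le> c * norm f"
  shows "(norm (C f))\<^sup>2 \<le> c * Re (cinner (C f) f)"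
proof -
  have "Re (cinner (C (C f)) (C f)) \<le> c * (norm (C f))\<^sup>2"
  proof -
    have "Re (cinner (C (C f)) (C f)) \<le> norm (C (C f)) * norm (C f)"
      using complex_Re_le_cmod norm_cinner_le by (rule order_trans)
    also have "\<dots> \<le> (c * norm (C f)) * norm (C f)"
      using bd by (rule mult_right_mono) simp
    finally show ?thesis by (simp add: power2_eq_square)
  qed
  moreover have "0 \<le> Re (cinner (C (f - (1/c) *\<^sub>R C f)) (f - (1/c) *\<^sub>R C f))"
    using pos by (simp add: op_le_def cinner.zero_left)
  moreover have "Re (cinner (C (f - (1/c) *\<^sub>R C f)) (f - (1/c) *\<^sub>R C f))
      = Re (cinner (C f) f) - 2 / c * (norm (C f))\<^sup>2 + Re (cinner (C (C f)) (C f)) / c\<^sup>2"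
    using selfadjoint_sym[OF C, of "C f" f]
    by (simp add: selfadjoint_linear[OF C] cinner.diff_left cinner.diff_right cinner_scaleR_left
        cinner_scaleR_right Re_cinner_self power2_eq_square diff_divide_distrib)
  ultimately have "0 \<le> Re (cinner (C f) f) - 2 / c * (norm (C f))\<^sup>2
      + c * (norm (C f))\<^sup>2 / c\<^sup>2"
    using c by (smt (verit) divide_right_mono zero_le_power2)
  then show ?thesis using c by (simp add: field_simps power2_eq_square)
qed

lemma positive_operator_eq_0:
  assumes C: "selfadjoint C" and pos: "op_le (\<lambda>_. 0) C" and "Re (cinner (C f) f) = 0"
  shows "C f = 0"
proof -
  obtain c where "c > 0" "\<And>f. norm (C f) \<le> norm f * c"
    using bounded_linear.pos_bounded[OF selfadjoint_bounded_linear[OF C]] by blast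
  then have "(norm (C f))\<^sup>2 \<le> c * Re (cinner (C f) f)"
    by (intro positive_operator_bound[OF C pos]) (auto simp: mult.commute)
  then show ?thesis using assms(3) by simp
qed

lemma op_le_antisym:
  assumes A: "selfadjoint A" and B: "selfadjoint B" and "op_le A B" "op_le B A"
  shows "A = B"
proof
  fix f
  have "B f - A f = 0"
    by (rule positive_operator_eq_0[OF selfadjoint_diff[OF B A]])
      (use assms(3,4) in \<open>auto simp: op_le_def cinner.zero_left cinner.diff_left intro!: antisym\<close>)
  then show "A f = B f" by simp
qed

section \<open>The positive square root\<close>

text \<open>\<open>U\<close> is the value at \<open>B\<close> of a polynomial with nonnegative coefficients and no constant
  term, and \<open>u\<close> is the sum of its coefficients, that is, its value at 1. If \<open>B\<close> is a contraction,
  \<open>u\<close> therefore bounds the norm of \<open>U\<close>; so the norm convergence of a sequence of operators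
  reduces to the convergence of a sequence of reals.\<close>

inductive nonneg_poly :: "('a::complex_inner \<Rightarrow> 'a) \<Rightarrow> ('a \<Rightarrow> 'a) \<Rightarrow> real \<Rightarrow> bool" for B where
  zero: "nonneg_poly B (\<lambda>_. 0) 0"
| var: "nonneg_poly B B 1"
| add: "nonneg_poly B U u \<Longrightarrow> nonneg_poly B V v \<Longrightarrow> nonneg_poly B (\<lambda>f. U f + V f) (u + v)"
| mult: "nonneg_poly B U u \<Longrightarrow> nonneg_poly B V v \<Longrightarrow> nonneg_poly B (\<lambda>f. U (V f)) (u * v)"
| half: "nonneg_poly B U u \<Longrightarrow> nonneg_poly B (\<lambda>f. (1/2) *\<^sub>R U f) (u / 2)"

lemma nonneg_poly_nonneg: "nonneg_poly B U u \<Longrightarrow> u \<ge> 0"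
  by (induction rule: nonneg_poly.induct) auto

lemma nonneg_poly_norm_le:
  assumes "nonneg_poly B U u" and B: "contraction B"
  shows "norm (U f) \<le> u * norm f"
  using assms(1)
proof (induction arbitrary: f rule: nonneg_poly.induct)
  case var
  then show ?case using B by (simp add: contraction_def)
next
  case (add U u V v)
  have "norm (U f + V f) \<le> norm (U f) + norm (V f)" by (rule norm_triangle_ineq)
  then show ?case using add.IH(1)[of f] add.IH(2)[of f] by (simp add: distrib_right)
next
  case (mult U u V v)
  have "norm (U (V f)) \<le> u * norm (V f)" by (rule mult.IH)
  also have "\<dots> \<le> u * (v * norm f)"
    using mult.IH(2) nonneg_poly_nonneg[OF mult.hyps(1)] by (rule mult_left_mono)
  finally show ?case by (simp add: mult.assoc)
next
  case (half U u)
  then show ?case using half.IH[of f] by simp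
qed simp

lemma nonneg_poly_commute:
  assumes "nonneg_poly B U u" and C: "bounded_linear C" and "\<And>f. C (B f) = B (C f)"
  shows "C (U f) = U (C f)"
  using assms(1)
proof (induction arbitrary: f rule: nonneg_poly.induct)
  case zero
  then show ?case using C by (simp add: linear_simps)
next
  case (add U u V v)
  then show ?case using C by (simp add: linear_simps)
next
  case (half U u)
  then show ?case using C by (simp add: linear_simps)
qed (use assms(3) in auto)

lemma nonneg_poly_bounded_linear:
  assumes "nonneg_poly B U u" and B: "bounded_linear B"
  shows "bounded_linear U"
  using assms(1)
proof (induction rule: nonneg_poly.induct)
  case (half U u)
  show ?case by (rule bounded_linear_compose[OF bounded_linear_scaleR_right half.IH])
qed (use B bounded_linear_add bounded_linear_compose in auto)

lemma nonneg_poly_selfadjoint: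
  assumes "nonneg_poly B U u" and B: "selfadjoint B"
  shows "cinner (U f) g = cinner f (U g)"
  using assms(1)
proof (induction arbitrary: f g rule: nonneg_poly.induct)
  case (mult U u V v)
  have bl: "bounded_linear U" "bounded_linear V"
    using mult.hyps nonneg_poly_bounded_linear selfadjoint_bounded_linear[OF B] by blast+
  have "V (B f) = B (V f)" for f
    by (rule nonneg_poly_commute[OF mult.hyps(2) selfadjoint_bounded_linear[OF B], symmetric])
      simp
  then have "V (U g) = U (V g)" by (rule nonneg_poly_commute[OF mult.hyps(1) bl(2)])
  then show ?case by (simp add: mult.IH)
qed (use B in \<open>auto simp: selfadjoint_sym cinner_add_left cinner_add_right cinner_scaleR_left
    cinner_scaleR_right cinner.zero_left cinner.zero_right\<close>)

text \<open>The two recursions compute the same polynomials \<open>p\<^sub>0 = 0\<close>,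
  \<open>p\<^sub>n\<^sub>+\<^sub>1(t) = (t + p\<^sub>n(t)\<^sup>2) / 2\<close>, at the operator \<open>B\<close> and at 1. They
  converge to the root \<open>1 - sqrt (1 - t)\<close> of \<open>p = (t + p\<^sup>2) / 2\<close>.\<close>

primrec sqrt_iter :: "('a::complex_inner \<Rightarrow> 'a) \<Rightarrow> nat \<Rightarrow> 'a \<Rightarrow> 'a" where
  "sqrt_iter B 0 = (\<lambda>_. 0)"
| "sqrt_iter B (Suc n) = (\<lambda>f. (1/2) *\<^sub>R (B f + sqrt_iter B n (sqrt_iter B n f)))"

primrec sqrt_iter1 :: "nat \<Rightarrow> real" where
  "sqrt_iter1 0 = 0"
| "sqrt_iter1 (Suc n) = (1 + sqrt_iter1 n * sqrt_iter1 n) / 2"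

lemma nonneg_poly_sqrt_iter: "nonneg_poly B (sqrt_iter B n) (sqrt_iter1 n)"
proof (induction n)
  case (Suc n)
  show ?case
    using nonneg_poly.half[OF nonneg_poly.add[OF nonneg_poly.var nonneg_poly.mult[OF Suc Suc]]]
    by simp
qed (simp add: nonneg_poly.zero)

text \<open>The increments have nonnegative coefficients too, by the factorization
  \<open>p\<^sub>n\<^sub>+\<^sub>1 - p\<^sub>n = (p\<^sub>n + p\<^sub>n\<^sub>-\<^sub>1)(p\<^sub>n - p\<^sub>n\<^sub>-\<^sub>1) / 2\<close>; for operators it uses that
  all polynomials in \<open>B\<close> commute.\<close>

lemma nonneg_poly_sqrt_iter_step:
  assumes B: "bounded_linear B"
  shows "nonneg_poly B (\<lambda>f. sqrt_iter B (Suc n) f - sqrt_iter B n f)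
    (sqrt_iter1 (Suc n) - sqrt_iter1 n)"
proof (induction n)
  case 0
  then show ?case using nonneg_poly.half[OF nonneg_poly.var[of B]] by simp
next
  case (Suc n)
  let ?Y = "sqrt_iter B" and ?y = sqrt_iter1
  have lin: "bounded_linear (?Y k)" for k
    using nonneg_poly_sqrt_iter B by (rule nonneg_poly_bounded_linear)
  have "?Y k (B f) = B (?Y k f)" for k f
    by (rule nonneg_poly_commute[OF nonneg_poly_sqrt_iter B, symmetric]) simp
  then have comm: "?Y k (?Y n f) = ?Y n (?Y k f)" for k f
    by (rule nonneg_poly_commute[OF nonneg_poly_sqrt_iter lin])
  have sub: "?Y k (f - g) = ?Y k f - ?Y k g" for k f g
    using lin[of k] by (simp add: linear_simps)
  have op: "?Y (Suc (Suc n)) f - ?Y (Suc n) f = (1/2) *\<^sub>R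
      (?Y (Suc n) (?Y (Suc n) f - ?Y n f) + ?Y n (?Y (Suc n) f - ?Y n f))" for f
  proof -
    have "?Y (Suc (Suc n)) f - ?Y (Suc n) f
        = (1/2) *\<^sub>R (?Y (Suc n) (?Y (Suc n) f) - ?Y n (?Y n f))"
      by (simp only: sqrt_iter.simps(2)[of B "Suc n"])
        (subst sqrt_iter.simps(2)[of B n], simp only: scaleR_diff_right[symmetric], simp)
    then show ?thesis using comm[of "Suc n" f] unfolding sub by simp
  qed
  have re: "?y (Suc (Suc n)) - ?y (Suc n)
      = (?y (Suc n) * (?y (Suc n) - ?y n) + ?y n * (?y (Suc n) - ?y n)) / 2"
    unfolding sqrt_iter1.simps(2)[of "Suc n"]
    by (simp only: sqrt_iter1.simps(2)[of n]) (simp add: field_simps)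
  have "nonneg_poly B (\<lambda>f. (1/2) *\<^sub>R
      (?Y (Suc n) (?Y (Suc n) f - ?Y n f) + ?Y n (?Y (Suc n) f - ?Y n f)))
      ((?y (Suc n) * (?y (Suc n) - ?y n) + ?y n * (?y (Suc n) - ?y n)) / 2)"
    using Suc.IH
    by (intro nonneg_poly.half nonneg_poly.add nonneg_poly.mult[of _ "?Y _"] nonneg_poly_sqrt_iter)
  then show ?case unfolding op re .
qed

lemma sqrt_iter1_le_1: "sqrt_iter1 n \<le> 1"
proof (induction n)
  case (Suc n)
  moreover have "0 \<le> sqrt_iter1 n"
    by (cases n) auto
  ultimately have "sqrt_iter1 n * sqrt_iter1 n \<le> 1" by (simp add: mult_le_one)
  then show ?case by simp
qed simp

lemma convergent_sqrt_iter1: "convergent sqrt_iter1"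
proof -
  have "sqrt_iter1 n \<le> sqrt_iter1 (Suc n)" for n
    using zero_le_square[of "sqrt_iter1 n - 1"] by (simp add: field_simps)
  then have "incseq sqrt_iter1" by (rule incseq_SucI)
  then show ?thesis
    using sqrt_iter1_le_1 incseq_convergent[of sqrt_iter1 1] convergent_def by blast
qed

lemma sqrt_iter_dist:
  assumes B: "bounded_linear B" "contraction B" and "m \<le> n"
  shows "norm (sqrt_iter B n f - sqrt_iter B m f) \<le> (sqrt_iter1 n - sqrt_iter1 m) * norm f"
  using \<open>m \<le> n\<close>
proof (induction rule: dec_induct)
  case (step k)
  have "norm (sqrt_iter B (Suc k) f - sqrt_iter B k f)
      \<le> (sqrt_iter1 (Suc k) - sqrt_iter1 k) * norm f"
    using nonneg_poly_sqrt_iter_step[OF B(1)] B(2) by (rule nonneg_poly_norm_le)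
  with step.IH norm_triangle_ineq[of "sqrt_iter B (Suc k) f - sqrt_iter B k f"
      "sqrt_iter B k f - sqrt_iter B m f"]
  show ?case by (simp add: algebra_simps del: sqrt_iter.simps sqrt_iter1.simps)
qed simp

lemma convergent_sqrt_iter:
  fixes B :: "'a::chilbert_space \<Rightarrow> 'a"
  assumes B: "bounded_linear B" "contraction B"
  shows "convergent (\<lambda>n. sqrt_iter B n f)"
proof (rule Cauchy_convergent, rule CauchyI')
  fix e :: real
  assume e: "e > 0"
  have pos: "0 < e / (norm f + 1)" using e by (simp add: add_nonneg_pos)
  obtain N where N: "\<And>m n. m \<ge> N \<Longrightarrow> n \<ge> N \<Longrightarrow> dist (sqrt_iter1 m) (sqrt_iter1 n) < e / (norm f + 1)"
    using metric_CauchyD[OF convergent_Cauchy[OF convergent_sqrt_iter1] pos] by blast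
  have "dist (sqrt_iter B m f) (sqrt_iter B n f) < e" if "m \<ge> N" "n > m" for m n
  proof -
    have "sqrt_iter1 n - sqrt_iter1 m < e / (norm f + 1)"
      using N[of m n] that by (auto simp: dist_real_def abs_less_iff)
    then have "(sqrt_iter1 n - sqrt_iter1 m) * norm f \<le> e / (norm f + 1) * norm f"
      by (intro mult_right_mono) auto
    also have "\<dots> < e"
      using e by (simp add: divide_less_eq add_nonneg_pos)
    finally show ?thesis
      using sqrt_iter_dist[OF B, of m n f] that
      by (simp add: dist_norm norm_minus_commute)
  qed
  then show "\<exists>N. \<forall>m\<ge>N. \<forall>n>m. dist (sqrt_iter B m f) (sqrt_iter B n f) < e"
    by blast
qed

text \<open>The limit is \<open>Y = I - (I - B)\<^sup>1\<^sup>/\<^sup>2\<close>. The recursion passes to the limit because the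
  iterates are contractions, so that strong convergence is compatible with products.\<close>

lemma sqrt_fixed_point_exists:
  fixes B :: "'a::chilbert_space \<Rightarrow> 'a"
  assumes B: "selfadjoint B" "contraction B"
  obtains Y where "selfadjoint Y" "contraction Y" "\<And>f. 2 *\<^sub>R Y f = B f + Y (Y f)"
    "\<And>C f. bounded_linear C \<Longrightarrow> (\<And>g. C (B g) = B (C g)) \<Longrightarrow> C (Y f) = Y (C f)"
proof -
  note bl = selfadjoint_bounded_linear[OF B(1)]
  let ?Y = "sqrt_iter B"
  define Y where "Y f = lim (\<lambda>n. ?Y n f)" for f
  have lim: "(\<lambda>n. ?Y n f) \<longlonglongrightarrow> Y f" for f
    using convergent_sqrt_iter[OF bl B(2), of f] by (simp add: Y_def convergent_LIMSEQ_iff)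
  have contr: "norm (?Y n f) \<le> norm f" for n f
  proof -
    have "norm (?Y n f) \<le> sqrt_iter1 n * norm f"
      using nonneg_poly_sqrt_iter B(2) by (rule nonneg_poly_norm_le)
    also have "\<dots> \<le> 1 * norm f" using sqrt_iter1_le_1 by (rule mult_right_mono) simp
    finally show ?thesis by simp
  qed
  have Ycontr: "norm (Y f) \<le> norm f" for f
    by (rule tendsto_upperbound[OF tendsto_norm[OF lim]]) (use contr in auto)
  have sym: "cinner (Y f) g = cinner f (Y g)" for f g
  proof (rule LIMSEQ_unique)
    show "(\<lambda>n. cinner (?Y n f) g) \<longlonglongrightarrow> cinner (Y f) g"
      by (rule cinner.tendsto[OF lim tendsto_const])
    have "(\<lambda>n. cinner f (?Y n g)) \<longlonglongrightarrow> cinner f (Y g)"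
      by (rule cinner.tendsto[OF tendsto_const lim])
    then show "(\<lambda>n. cinner (?Y n f) g) \<longlonglongrightarrow> cinner f (Y g)"
      by (simp add: nonneg_poly_selfadjoint[OF nonneg_poly_sqrt_iter B(1)])
  qed
  have sa: "selfadjoint Y"
    by (rule selfadjointI[of _ 1]) (use sym Ycontr in auto)
  have prod: "(\<lambda>n. ?Y n (?Y n f)) \<longlonglongrightarrow> Y (Y f)" for f
  proof -
    have lin: "bounded_linear (?Y n)" for n
      using nonneg_poly_sqrt_iter bl by (rule nonneg_poly_bounded_linear)
    have "(\<lambda>n. ?Y n (?Y n f - Y f)) \<longlonglongrightarrow> 0"
    proof (rule Lim_null_comparison)
      show "\<forall>\<^sub>F n in sequentially. norm (?Y n (?Y n f - Y f)) \<le> norm (?Y n f - Y f)"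
        using contr by simp
      show "(\<lambda>n. norm (?Y n f - Y f)) \<longlonglongrightarrow> 0"
        using lim[of f] by (intro tendsto_norm_zero) (simp add: LIM_zero)
    qed
    from tendsto_add[OF this lim[of "Y f"]] show ?thesis
      using lin by (simp add: linear_simps)
  qed
  have fixp: "2 *\<^sub>R Y f = B f + Y (Y f)" for f
  proof (rule LIMSEQ_unique)
    have "(\<lambda>n. ?Y (Suc n) f) \<longlonglongrightarrow> Y f" using lim by (rule LIMSEQ_Suc)
    then show "(\<lambda>n. 2 *\<^sub>R ?Y (Suc n) f) \<longlonglongrightarrow> 2 *\<^sub>R Y f" by (intro tendsto_intros)
    show "(\<lambda>n. 2 *\<^sub>R ?Y (Suc n) f) \<longlonglongrightarrow> B f + Y (Y f)"
      using tendsto_add[OF tendsto_const prod] by simp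
  qed
  have comm: "C (Y f) = Y (C f)" if C: "bounded_linear C" and "\<And>g. C (B g) = B (C g)" for C f
  proof (rule LIMSEQ_unique)
    show "(\<lambda>n. C (?Y n f)) \<longlonglongrightarrow> C (Y f)" using C lim by (rule bounded_linear.tendsto)
    show "(\<lambda>n. C (?Y n f)) \<longlonglongrightarrow> Y (C f)"
      unfolding nonneg_poly_commute[of B "?Y _", OF nonneg_poly_sqrt_iter that] by (rule lim)
  qed
  show thesis by (rule that[OF sa _ fixp comm]) (simp add: contraction_def Ycontr)
qed

definition is_positive_sqrt :: "('a::complex_inner \<Rightarrow> 'a) \<Rightarrow> ('a \<Rightarrow> 'a) \<Rightarrow> bool" where
  "is_positive_sqrt A S \<longleftrightarrow> selfadjoint S \<and> op_le (\<lambda>_. 0) S \<and> S \<circ> S = A"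

lemma positive_sqrt_exists:
  fixes A :: "'a::chilbert_space \<Rightarrow> 'a"
  assumes A: "selfadjoint A" "op_le (\<lambda>_. 0) A"
  obtains S where "is_positive_sqrt A S"
    "\<And>C f. bounded_linear C \<Longrightarrow> (\<And>g. C (A g) = A (C g)) \<Longrightarrow> C (S f) = S (C f)"
proof -
  obtain c where c: "c > 0" and bd: "\<And>f. norm (A f) \<le> norm f * c"
    using bounded_linear.pos_bounded[OF selfadjoint_bounded_linear[OF A(1)]] by blast
  have AA: "(norm (A f))\<^sup>2 \<le> c * Re (cinner (A f) f)" for f
    using A c bd by (intro positive_operator_bound) (auto simp: mult.commute)
  have Apos: "0 \<le> Re (cinner (A f) f)" for f using A(2) by (simp add: op_le_def cinner.zero_left)
  define B where "B f = f - (1/c) *\<^sub>R A f" for f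
  have Bc: "norm (B f) \<le> norm f" for f
  proof -
    have "(norm (B f))\<^sup>2 = (norm f)\<^sup>2 - 2 / c * Re (cinner (A f) f) + (norm (A f))\<^sup>2 / c\<^sup>2"
      unfolding B_def norm_diff_square using c Re_cinner_commute[of f "A f"]
      by (simp add: cinner_scaleR_right power_divide)
    also have "\<dots> \<le> (norm f)\<^sup>2 - 2 / c * Re (cinner (A f) f)
        + (c * Re (cinner (A f) f)) / c\<^sup>2"
      using AA by (intro add_left_mono divide_right_mono) simp_all
    also have "\<dots> = (norm f)\<^sup>2 - Re (cinner (A f) f) / c"
      using c by (simp add: field_simps power2_eq_square)
    also have "\<dots> \<le> (norm f)\<^sup>2" using c Apos[of f] by simp
    finally show ?thesis by (rule power2_le_imp_le[OF _ norm_ge_zero])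
  qed
  have Bsym: "cinner (B f) g = cinner f (B g)" for f g
    by (simp add: B_def cinner.diff_left cinner.diff_right cinner_scaleR_left cinner_scaleR_right
        selfadjoint_sym[OF A(1)])
  have B: "selfadjoint B" "contraction B"
    using Bc Bsym by (auto intro: selfadjointI[of _ 1] simp: contraction_def)
  from sqrt_fixed_point_exists[OF B] obtain Y where
    Y: "selfadjoint Y" "contraction Y" and fixp: "\<And>f. 2 *\<^sub>R Y f = B f + Y (Y f)"
    and comm: "\<And>C f. bounded_linear C \<Longrightarrow> (\<And>g. C (B g) = B (C g)) \<Longrightarrow> C (Y f) = Y (C f)"
    by blast
  note Ylin = selfadjoint_linear[OF Y(1)]
  define S where "S f = sqrt c *\<^sub>R (f - Y f)" for f
  have "norm (S f) \<le> (sqrt c * 2) * norm f" for f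
  proof -
    have "norm (f - Y f) \<le> 2 * norm f"
      using norm_triangle_ineq4[of f "Y f"] Y(2)[unfolded contraction_def, rule_format, of f]
      by linarith
    then show ?thesis using c by (simp add: S_def mult.assoc mult_left_mono)
  qed
  then have sa: "selfadjoint S"
    by (intro selfadjointI) (auto simp: S_def cinner_scaleR_left cinner_scaleR_right
        cinner.diff_left cinner.diff_right selfadjoint_sym[OF Y(1)])
  have "Re (cinner (S f) f) \<ge> 0" for f
  proof -
    have "Re (cinner (Y f) f) \<le> norm (Y f) * norm f"
      using complex_Re_le_cmod norm_cinner_le by (rule order_trans)
    also have "\<dots> \<le> norm f * norm f"
      using Y(2) by (intro mult_right_mono) (auto simp: contraction_def)
    finally show ?thesis
      using c by (simp add: S_def cinner_scaleR_left cinner.diff_left Re_cinner_self power2_eq_square)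
  qed
  then have pos: "op_le (\<lambda>_. 0) S" by (simp add: op_le_def cinner.zero_left)
  have "S (S f) = A f" for f
  proof -
    have "S (S f) = (sqrt c * sqrt c) *\<^sub>R ((f - Y f) - (Y f - Y (Y f)))"
      by (simp only: S_def Ylin scaleR_diff_right scaleR_scaleR)
    also have "\<dots> = c *\<^sub>R (f - 2 *\<^sub>R Y f + Y (Y f))"
      using c by (simp add: scaleR_2 diff_diff_eq)
    also have "\<dots> = c *\<^sub>R (f - B f)" by (simp add: fixp)
    also have "\<dots> = A f" using c by (simp add: B_def)
    finally show ?thesis .
  qed
  then have sq: "S \<circ> S = A" by auto
  have comm': "C (S f) = S (C f)" if C: "bounded_linear C" and CA: "\<And>g. C (A g) = A (C g)" for C f
  proof -
    have "C (B g) = B (C g)" for g using C CA by (simp add: B_def linear_simps)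
    from comm[OF C this] show ?thesis using C by (simp add: S_def linear_simps)
  qed
  show thesis
    by (rule that[OF _ comm']) (simp add: is_positive_sqrt_def sa pos sq)
qed

text \<open>Let \<open>S\<close> be the root just constructed and \<open>R\<close> another one. \<open>R\<close> commutes with \<open>A = R\<^sup>2\<close>, hence
  with \<open>S\<close>, and \<open>(S + R)(S - R) = 0\<close>. So the forms of \<open>S\<close> and \<open>R\<close> vanish at
  \<open>g = (S - R) f\<close>, whence \<open>S g = R g = 0\<close> and \<open>\<parallel>g\<parallel>\<^sup>2 = ((S - R) g, f) = 0\<close>.\<close>

lemma positive_sqrt_ex1:
  fixes A :: "'a::chilbert_space \<Rightarrow> 'a"
  assumes A: "selfadjoint A" "op_le (\<lambda>_. 0) A"
  shows "\<exists>!S. is_positive_sqrt A S"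
proof -
  from positive_sqrt_exists[OF A] obtain S where S: "is_positive_sqrt A S"
    and comm: "\<And>C f. bounded_linear C \<Longrightarrow> (\<And>g. C (A g) = A (C g)) \<Longrightarrow> C (S f) = S (C f)"
    by blast
  have Ssa: "selfadjoint S" and Spos: "op_le (\<lambda>_. 0) S" and SS: "\<And>f. S (S f) = A f"
    using S by (auto simp: is_positive_sqrt_def)
  have "R = S" if R: "is_positive_sqrt A R" for R
  proof
    fix f
    have Rsa: "selfadjoint R" and Rpos: "op_le (\<lambda>_. 0) R" and RR: "\<And>f. R (R f) = A f"
      using R by (auto simp: is_positive_sqrt_def)
    have RS: "R (S h) = S (R h)" for h
      by (rule comm[OF selfadjoint_bounded_linear[OF Rsa]]) (simp add: RR[symmetric])
    define g where "g = S f - R f"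
    have "S g + R g = 0"
      by (simp add: g_def selfadjoint_linear[OF Ssa] selfadjoint_linear[OF Rsa] SS RR RS)
    then have "Re (cinner (S g) g) + Re (cinner (R g) g) = 0"
      by (metis cinner_add_left cinner.zero_left plus_complex.sel(1) zero_complex.sel(1))
    moreover have "Re (cinner (S g) g) \<ge> 0" "Re (cinner (R g) g) \<ge> 0"
      using Spos Rpos by (simp_all add: op_le_def cinner.zero_left)
    ultimately have "Re (cinner (S g) g) = 0" "Re (cinner (R g) g) = 0" by linarith+
    then have "S g = 0" "R g = 0"
      using positive_operator_eq_0 Ssa Spos Rsa Rpos by blast+
    moreover have "cinner g g = cinner f (S g - R g)"
      by (subst (1) g_def) (simp add: cinner.diff_left cinner.diff_right
          selfadjoint_sym[OF Ssa] selfadjoint_sym[OF Rsa])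
    ultimately have "cinner g g = 0" by (simp add: cinner.zero_right)
    then show "R f = S f" by (simp add: cinner_self g_def)
  qed
  with S show ?thesis by blast
qed

lemma positive_sqrt_commute:
  fixes A :: "'a::chilbert_space \<Rightarrow> 'a"
  assumes A: "selfadjoint A" "op_le (\<lambda>_. 0) A" and S: "is_positive_sqrt A S"
    and C: "bounded_linear C" "\<And>g. C (A g) = A (C g)"
  shows "C (S f) = S (C f)"
proof -
  from positive_sqrt_exists[OF A] obtain R where R: "is_positive_sqrt A R"
    and comm: "\<And>C f. bounded_linear C \<Longrightarrow> (\<And>g. C (A g) = A (C g)) \<Longrightarrow> C (R f) = R (C f)"
    by blast
  have "R = S" using positive_sqrt_ex1[OF A] R S by blast
  with comm[OF C] show ?thesis by simp
qed

lemma op_sqrt_is_positive_sqrt: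
  fixes A :: "'a::chilbert_space \<Rightarrow> 'a"
  assumes "selfadjoint A" "op_le (\<lambda>_. 0) A"
  shows "is_positive_sqrt A (op_sqrt A)"
  using theI'[OF positive_sqrt_ex1[OF assms]] by (simp add: op_sqrt_def is_positive_sqrt_def)

section \<open>Graph subspaces of a Krein space\<close>

lemma krein_uminus: "krein (\<lambda>f. - J f) f g = - krein J f g"
  by (simp add: krein_def cinner.minus_left)

lemma H_minus_eq_H_plus: "H_minus J = H_plus (\<lambda>f. - J f)"
  by (simp add: H_minus_def H_plus_def P_minus_def[abs_def] P_plus_def[abs_def])

lemma maximal_negative_eq_maximal_positive:
  "maximal_negative J L = maximal_positive (\<lambda>f. - J f) L"
  by (simp add: maximal_negative_def maximal_positive_def negative_subspace_def
      positive_subspace_def krein_uminus)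

text \<open>With \<open>J\<close> also \<open>-J\<close> is an instance. Passing from one to the other interchanges \<open>H\<^sub>+\<close> with
  \<open>H\<^sub>-\<close> and positive with negative subspaces, so that facts about \<open>H\<^sub>-\<close> follow from those about
  \<open>H\<^sub>+\<close>.\<close>

locale krein_space =
  fixes J :: "'a::complex_inner \<Rightarrow> 'a"
  assumes J: "selfadjoint J" and JJ [simp]: "J (J f) = f"
begin

lemmas J_linear = selfadjoint_linear[OF J]

lemma cinner_J: "cinner (J f) g = cinner f (J g)"
  by (rule selfadjoint_sym[OF J])

lemma norm_J [simp]: "norm (J f) = norm f"
proof -
  have "(norm (J f))\<^sup>2 = (norm f)\<^sup>2" by (simp add: Re_cinner_self[symmetric] cinner_J)
  then show ?thesis by simp
qed

lemma uminus_J: "krein_space (\<lambda>f. - J f)"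
proof
  show "selfadjoint (\<lambda>f. - J f)"
    by (rule selfadjointI[of _ 1]) (simp_all add: cinner.minus_left cinner.minus_right cinner_J)
qed (simp add: J_linear)

lemma J_P_plus: "J (P_plus J f) = P_plus J f"
  by (simp add: P_plus_def J_linear add.commute)

lemma J_P_minus: "J (P_minus J f) = - P_minus J f"
  by (simp add: P_minus_def J_linear scaleR_minus_right[symmetric] del: scaleR_minus_right)

lemma P_plus_add_P_minus: "P_plus J f + P_minus J f = f"
  by (simp add: P_plus_def P_minus_def scaleR_add_right[symmetric] scaleR_2[symmetric]
      del: scaleR_add_right)

lemma P_plus_split: "J x = x \<Longrightarrow> J y = - y \<Longrightarrow> P_plus J (x + y) = x"
  by (simp add: P_plus_def J_linear scaleR_2[symmetric])

lemma P_minus_split: "J x = x \<Longrightarrow> J y = - y \<Longrightarrow> P_minus J (x + y) = y"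
  by (simp add: P_minus_def J_linear scaleR_2[symmetric])

lemma mem_H_plus: "f \<in> H_plus J \<longleftrightarrow> J f = f"
proof
  show "f \<in> H_plus J \<Longrightarrow> J f = f" by (auto simp: H_plus_def J_P_plus)
  assume "J f = f"
  then have "P_plus J f = f" using P_plus_split[of f 0] by (simp add: J_linear)
  then show "f \<in> H_plus J" unfolding H_plus_def by (metis rangeI)
qed

lemma mem_H_minus: "f \<in> H_minus J \<longleftrightarrow> J f = - f"
  using krein_space.mem_H_plus[OF uminus_J, of f]
  by (simp add: H_minus_eq_H_plus minus_equation_iff[of "J f"] eq_commute[of "- f"])

lemma H_plus_orthogonal_H_minus: "J f = f \<Longrightarrow> J g = - g \<Longrightarrow> cinner f g = 0"
  using cinner_J[of f g] by (simp add: cinner.minus_right)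

lemma norm_add_H_plus_H_minus:
  assumes "J x = x" "J y = - y"
  shows "(norm (x + y))\<^sup>2 = (norm x)\<^sup>2 + (norm y)\<^sup>2"
  using H_plus_orthogonal_H_minus[OF assms] by (simp add: norm_add_square)

lemma bounded_linear_P_plus: "bounded_linear (P_plus J)"
  unfolding P_plus_def[abs_def]
  by (intro bounded_linear_compose[OF bounded_linear_scaleR_right] bounded_linear_add
      bounded_linear_ident selfadjoint_bounded_linear[OF J])

lemma closed_csubspace_H_plus: "closed_csubspace (H_plus J)"
proof -
  have "H_plus J = {f. J f = f}" by (auto simp: mem_H_plus)
  moreover have "closed {f. J f = f}"
    by (intro closed_Collect_eq continuous_on_id
        bounded_linear.continuous_on[OF selfadjoint_bounded_linear[OF J]])
  ultimately show ?thesis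
    by (simp add: closed_csubspace_def complex_vector.subspace_def J_linear)
qed

lemma closed_csubspace_H_minus: "closed_csubspace (H_minus J)"
  unfolding H_minus_eq_H_plus by (rule krein_space.closed_csubspace_H_plus[OF uminus_J])

definition anticommutes :: "('a \<Rightarrow> 'a) \<Rightarrow> bool" where
  "anticommutes T \<longleftrightarrow> (\<forall>f. J (T f) = - T (J f))"

lemma anticommutesI:
  assumes T: "selfadjoint T"
    and plus: "\<And>f. J f = f \<Longrightarrow> J (T f) = - T f"
    and minus: "\<And>f. J f = - f \<Longrightarrow> J (T f) = T f"
  shows "anticommutes T"
  unfolding anticommutes_def
proof
  fix f
  define x y where "x = P_plus J f" and "y = P_minus J f"
  have f: "f = x + y" and x: "J x = x" and y: "J y = - y"
    by (simp_all add: x_def y_def P_plus_add_P_minus J_P_plus J_P_minus)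
  show "J (T f) = - T (J f)"
    by (simp add: f J_linear selfadjoint_linear[OF T] x y plus[OF x] minus[OF y])
qed

text \<open>If \<open>T\<close> maps \<open>H\<^sub>+\<close> into \<open>H\<^sub>-\<close>, then \<open>[f + T f, f + T f] = \<parallel>f\<parallel>\<^sup>2 - \<parallel>T f\<parallel>\<^sup>2\<close> on
  \<open>H\<^sub>+\<close>. A larger subspace would contain a nonzero vector with vanishing \<open>H\<^sub>+\<close> component,
  and the form is negative there.\<close>

lemma graph_maximal_positive:
  assumes T: "selfadjoint T" and anti: "anticommutes T"
    and strong: "strong_contraction_on (H_plus J) T"
  shows "maximal_positive J ((\<lambda>f. f + T f) ` H_plus J)"
proof -
  let ?L = "(\<lambda>f. f + T f) ` H_plus J"
  note Tlin = selfadjoint_linear[OF T]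
  have JT: "J (T f) = - T f" if "J f = f" for f
    using anti that by (simp add: anticommutes_def)
  have L_eq: "?L = {h. h = P_plus J h + T (P_plus J h)}"
  proof (intro equalityI subsetI)
    fix h assume "h \<in> ?L"
    then obtain f where "J f = f" "h = f + T f" by (auto simp: mem_H_plus)
    then show "h \<in> {h. h = P_plus J h + T (P_plus J h)}" by (simp add: P_plus_split JT)
  next
    fix h assume "h \<in> {h. h = P_plus J h + T (P_plus J h)}"
    then show "h \<in> ?L"
      by (intro image_eqI[of _ _ "P_plus J h"]) (auto simp: mem_H_plus J_P_plus)
  qed
  have "closed ?L"
    unfolding L_eq
    by (intro closed_Collect_eq continuous_on_id continuous_on_add
        bounded_linear.continuous_on[OF bounded_linear_P_plus]
        bounded_linear.continuous_on[OF selfadjoint_bounded_linear[OF T]])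
  moreover have "complex_vector.subspace ?L"
    using closed_csubspace_H_plus
    unfolding closed_csubspace_def complex_vector.subspace_def ball_simps image_iff
  proof (intro conjI ballI allI; elim conjE)
    show "\<exists>x\<in>H_plus J. 0 = x + T x" if "0 \<in> H_plus J"
      using that by (intro bexI[of _ 0]) (simp_all add: Tlin)
    show "\<exists>x\<in>H_plus J. f + T f + (g + T g) = x + T x"
      if "f \<in> H_plus J" "g \<in> H_plus J" "\<forall>x\<in>H_plus J. \<forall>y\<in>H_plus J. x + y \<in> H_plus J" for f g
      using that by (intro bexI[of _ "f + g"]) (simp_all add: Tlin)
    show "\<exists>x\<in>H_plus J. c *\<^sub>C (f + T f) = x + T x"
      if "f \<in> H_plus J" "\<forall>c. \<forall>x\<in>H_plus J. c *\<^sub>C x \<in> H_plus J" for c f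
      using that by (intro bexI[of _ "c *\<^sub>C f"]) (simp_all add: Tlin scaleC_add_right)
  qed
  moreover have "Re (krein J h h) > 0" if "h \<in> ?L" "h \<noteq> 0" for h
  proof -
    from that obtain f where f: "J f = f" "h = f + T f" by (auto simp: mem_H_plus)
    with \<open>h \<noteq> 0\<close> have "f \<noteq> 0" by (auto simp: Tlin)
    with strong f have less: "norm (T f) < norm f"
      by (simp add: strong_contraction_on_def mem_H_plus)
    have "Re (krein J h h) = (norm f)\<^sup>2 - (norm (T f))\<^sup>2"
      using Re_cinner_commute[of f "T f"]
      by (simp add: krein_def f J_linear JT cinner_add_left cinner_add_right cinner.diff_left
          Re_cinner_self)
    moreover have "(norm (T f))\<^sup>2 < (norm f)\<^sup>2"
      using less by (rule power_strict_mono) simp_all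
    ultimately show ?thesis by simp
  qed
  ultimately have pos: "positive_subspace J ?L"
    by (simp add: positive_subspace_def closed_csubspace_def)
  have "\<not> ?L \<subset> L'" if L': "positive_subspace J L'" for L'
  proof
    assume sub: "?L \<subset> L'"
    then obtain h where h: "h \<in> L'" "h \<notin> ?L" by blast
    define g where "g = h - (P_plus J h + T (P_plus J h))"
    have "P_plus J h + T (P_plus J h) \<in> L'"
      using psubset_imp_subset[OF sub]
      by (rule subsetD) (intro imageI, simp add: mem_H_plus J_P_plus)
    then have "g \<in> L'"
      using L' h(1) unfolding g_def
      by (simp add: positive_subspace_def closed_csubspace_def complex_vector.subspace_diff)
    moreover have "g \<noteq> 0" using h(2) by (auto simp: g_def L_eq)
    ultimately have "Re (krein J g g) > 0" using L' by (simp add: positive_subspace_def)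
    moreover have "J g = - g"
    proof -
      have g: "g = P_minus J h - T (P_plus J h)"
        using P_plus_add_P_minus[of h] unfolding g_def by (metis add_diff_cancel_left diff_diff_add)
      show ?thesis unfolding g by (simp add: J_linear J_P_minus JT J_P_plus)
    qed
    ultimately have "(norm g)\<^sup>2 < 0" by (simp add: krein_def cinner.minus_left Re_cinner_self)
    then show False by simp
  qed
  with pos show ?thesis by (auto simp: maximal_positive_def)
qed

lemma graph_maximal_negative:
  assumes "selfadjoint T" and "anticommutes T" and "strong_contraction_on (H_minus J) T"
  shows "maximal_negative J ((\<lambda>f. f + T f) ` H_minus J)"
proof -
  interpret neg: krein_space "\<lambda>f. - J f" by (rule uminus_J)
  have "neg.anticommutes T"
    using assms(1,2) by (simp add: anticommutes_def neg.anticommutes_def selfadjoint_linear)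
  then show ?thesis
    using assms neg.graph_maximal_positive[of T]
    by (simp add: maximal_negative_eq_maximal_positive H_minus_eq_H_plus)
qed

lemma graph_dual_maximal:
  assumes T: "selfadjoint T" and anti: "anticommutes T"
    and "strong_contraction_on (H_plus J) T" "strong_contraction_on (H_minus J) T"
  shows "dual_maximal J ((\<lambda>f. f + T f) ` H_plus J) ((\<lambda>f. f + T f) ` H_minus J)"
proof -
  have "krein J (f + T f) (g + T g) = 0" if f: "J f = f" and g: "J g = - g" for f g
  proof -
    have Tf: "J (T f) = - T f" and Tg: "J (T g) = T g"
      using anti f g by (simp_all add: anticommutes_def selfadjoint_linear[OF T])
    have "cinner f g = 0" "cinner (T g) (T f) = 0"
      using H_plus_orthogonal_H_minus f g Tf Tg by blast+
    then have "cinner f g = 0" "cinner (T f) (T g) = 0"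
      by (simp, subst cinner_commute, simp)
    then show ?thesis
      by (simp add: krein_def J_linear f Tf cinner_add_left cinner_add_right cinner.diff_left
          selfadjoint_sym[OF T])
  qed
  with graph_maximal_positive[OF T anti] graph_maximal_negative[OF T anti] assms(3,4)
  show ?thesis
    by (auto simp: dual_maximal_def dual_definite_def maximal_positive_def maximal_negative_def
        mem_H_plus mem_H_minus)
qed

section \<open>Dense range of \<open>I + T\<close>\<close>

text \<open>If \<open>\<parallel>T f\<parallel> = \<parallel>f\<parallel>\<close>, then \<open>T\<^sup>2 f = f\<close>, so \<open>z = f + T f\<close> is fixed by \<open>T\<close> and
  \<open>J z\<close> is an eigenvector of \<open>T\<close> for \<open>-1\<close>, orthogonal to the range of \<open>I + T\<close>.\<close>

lemma anticommutes_strong_contraction: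
  assumes T: "selfadjoint T" "contraction T" and anti: "anticommutes T"
    and dense: "closure (range (\<lambda>f. f + T f)) = UNIV"
  shows "strong_contraction_on (H_plus J) T" "strong_contraction_on (H_minus J) T"
proof -
  note Tlin = selfadjoint_linear[OF T(1)]
  have "norm (T f) < norm f" if f: "J f = f \<or> J f = - f" and nz: "f \<noteq> 0" for f
  proof (rule ccontr)
    assume "\<not> norm (T f) < norm f"
    then have eq: "norm (T f) = norm f" using T(2) by (simp add: contraction_def antisym)
    have "Re (cinner (T (T f)) f) = (norm f)\<^sup>2"
      by (simp add: selfadjoint_sym[OF T(1), of "T f"] Re_cinner_self eq)
    then have "(norm (T (T f) - f))\<^sup>2 = (norm (T (T f)))\<^sup>2 - (norm f)\<^sup>2"
      by (simp add: norm_diff_square)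
    also have "\<dots> \<le> 0"
      using T(2) eq by (simp add: contraction_def) (metis power_mono norm_ge_zero)
    finally have TT: "T (T f) = f" by simp
    define z where "z = f + T f"
    have Tz: "T (J z) = - J z"
      using anti unfolding anticommutes_def
      by (metis z_def Tlin(1) TT add.commute minus_equation_iff)
    have "J z = 0"
    proof (rule orthogonal_closure_eq_0)
      show "J z \<in> closure (range (\<lambda>f. f + T f))" by (simp add: dense)
      fix v assume "v \<in> range (\<lambda>f. f + T f)"
      then obtain g where "v = g + T g" by auto
      then show "cinner (J z) v = 0"
        by (simp add: cinner_add_right selfadjoint_sym[OF T(1), symmetric] Tz cinner.minus_left)
    qed
    then have "z = 0" using norm_J[of z] by simp
    then have Tf: "T f = - f" by (simp add: z_def eq_neg_iff_add_eq_0 add.commute)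
    have "J (T f) = - T (J f)" using anti by (simp add: anticommutes_def)
    with f Tf have "f = - f" by (auto simp: J_linear Tlin)
    then have "2 *\<^sub>R f = 0" by (metis add.right_inverse scaleR_2)
    with nz show False by simp
  qed
  then show "strong_contraction_on (H_plus J) T" "strong_contraction_on (H_minus J) T"
    by (auto simp: strong_contraction_on_def mem_H_plus mem_H_minus)
qed

text \<open>For \<open>f\<close> in \<open>H\<^sub>+\<close> the vector \<open>J (I + T) f - (I - T) f\<close> is orthogonal to
  \<open>(I + T) M\<^sub>+\<close> by symmetry of \<open>T\<close>, because there \<open>J (I + T) = I - T\<close>. By
  duality it is also orthogonal to \<open>(I + T) M\<^sub>-\<close>, where \<open>J (I + T) = T - I\<close>. Hence it
  vanishes, which is to say that \<open>T f\<close> lies in \<open>H\<^sub>-\<close>. Behind this is the Cayley transform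
  \<open>G = (I - T) (I + T)\<^sup>-\<^sup>1\<close>: it agrees with the operator that is \<open>J\<close> on \<open>(I + T) H\<^sub>+\<close> and
  \<open>-J\<close> on \<open>(I + T) H\<^sub>-\<close>, because both have the same domain and are restrictions of the adjoint of
  one densely defined operator.\<close>

lemma dual_graph_maps_H_plus_to_H_minus:
  assumes T: "selfadjoint T"
    and Mp: "\<And>g. g \<in> Mp \<Longrightarrow> J g = g \<and> J (T g) = - T g"
    and Mm: "\<And>h. h \<in> Mm \<Longrightarrow> J h = - h \<and> J (T h) = T h"
    and dual: "\<And>f h. J f = f \<Longrightarrow> h \<in> Mm \<Longrightarrow> krein J (f + T f) (h + T h) = 0"
    and dense: "closure {(g + T g) + (h + T h) | g h. g \<in> Mp \<and> h \<in> Mm} = UNIV"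
    and f: "J f = f"
  shows "J (T f) = - T f"
proof -
  define w where "w = J (f + T f) - (f - T f)"
  have "w = 0"
  proof (rule orthogonal_closure_eq_0)
    show "w \<in> closure {(g + T g) + (h + T h) | g h. g \<in> Mp \<and> h \<in> Mm}" by (simp add: dense)
    fix v assume "v \<in> {(g + T g) + (h + T h) | g h. g \<in> Mp \<and> h \<in> Mm}"
    then obtain g h where g: "g \<in> Mp" and h: "h \<in> Mm" and v: "v = (g + T g) + (h + T h)" by blast
    have "cinner w (g + T g) = cinner (f + T f) (J (g + T g)) - cinner (f - T f) (g + T g)"
      by (simp add: w_def cinner.diff_left cinner_J)
    also have "J (g + T g) = g - T g" using Mp[OF g] by (simp add: J_linear)
    also have "cinner (f + T f) (g - T g) - cinner (f - T f) (g + T g) = 0"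
      by (simp add: cinner.diff_left cinner.diff_right cinner_add_left cinner_add_right
          selfadjoint_sym[OF T])
    finally have 1: "cinner w (g + T g) = 0" .
    have kr: "cinner (J (f + T f)) (h + T h) = 0"
      using dual[OF f h] by (simp add: krein_def)
    have "cinner (f - T f) (h + T h) = - cinner (f + T f) (T h - h)"
      by (simp add: cinner.diff_left cinner.diff_right cinner_add_left cinner_add_right
          selfadjoint_sym[OF T])
    also have "T h - h = J (h + T h)" using Mm[OF h] by (simp add: J_linear)
    finally have "cinner (f - T f) (h + T h) = 0" using kr by (simp add: cinner_J)
    then have 2: "cinner w (h + T h) = 0" using kr by (simp add: w_def cinner.diff_left)
    show "cinner w v = 0" using 1 2 by (simp add: v cinner.add_right)
  qed
  then have "J (T f) + T f = 0" using f by (simp add: w_def J_linear)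
  then show ?thesis by (simp add: eq_neg_iff_add_eq_0)
qed

lemma dual_graphs_anticommute:
  assumes T: "selfadjoint T"
    and Mp: "\<And>g. g \<in> Mp \<Longrightarrow> J g = g \<and> J (T g) = - T g"
    and Mm: "\<And>h. h \<in> Mm \<Longrightarrow> J h = - h \<and> J (T h) = T h"
    and dual: "\<And>f h. J f = f \<Longrightarrow> J h = - h \<Longrightarrow> krein J (f + T f) (h + T h) = 0"
    and dense: "closure {(g + T g) + (h + T h) | g h. g \<in> Mp \<and> h \<in> Mm} = UNIV"
  shows "anticommutes T"
proof (rule anticommutesI[OF T])
  show "J (T f) = - T f" if "J f = f" for f
    using T Mp Mm dual dense that by (intro dual_graph_maps_H_plus_to_H_minus[of T Mp Mm f]) auto
  show "J (T f) = T f" if f: "J f = - f" for f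
  proof -
    interpret neg: krein_space "\<lambda>f. - J f" by (rule uminus_J)
    have dual': "krein J (h + T h) (g + T g) = 0" if "J h = - h" "J g = g" for g h
    proof -
      have "krein J (h + T h) (g + T g) = cnj (krein J (g + T g) (h + T h))"
        unfolding krein_def by (subst cinner_J) (rule cinner_commute)
      then show ?thesis using dual that by simp
    qed
    have "{(g + T g) + (h + T h) | g h. g \<in> Mm \<and> h \<in> Mp}
        = {(g + T g) + (h + T h) | g h. g \<in> Mp \<and> h \<in> Mm}"
      by (auto simp: add.commute) (metis add.commute)+
    then have "- J (T f) = - T f"
      using T Mp Mm dual' dense f
      by (intro neg.dual_graph_maps_H_plus_to_H_minus[of T Mm Mp f])
        (auto simp: krein_uminus minus_equation_iff[of "J _"])
    then show ?thesis by simp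
  qed
qed

section \<open>The operator equation\<close>

lemma diff_add_mem_closure_range:
  fixes A :: "'a \<Rightarrow> 'a"
  assumes A: "selfadjoint A" and "a \<in> closure (range A)" "b \<in> closure (range A)"
    "c \<in> closure (range A)"
  shows "a - b + c \<in> closure (range A)"
proof -
  obtain x y z where lims: "x \<longlonglongrightarrow> a" "y \<longlonglongrightarrow> b" "z \<longlonglongrightarrow> c"
    and range: "\<And>n. x n \<in> range A" "\<And>n. y n \<in> range A" "\<And>n. z n \<in> range A"
    using assms(2-4) unfolding closure_sequential by metis
  have "x n - y n + z n \<in> range A" for n
  proof -
    obtain u v w where "x n = A u" "y n = A v" "z n = A w"
      using range[of n] by blast
    then have "x n - y n + z n = A (u - v + w)" by (simp add: selfadjoint_linear[OF A])
    then show ?thesis by blast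
  qed
  moreover have "(\<lambda>n. x n - y n + z n) \<longlonglongrightarrow> a - b + c"
    using lims by (intro tendsto_intros)
  ultimately show ?thesis
    unfolding closure_sequential by (intro exI[of _ "\<lambda>n. x n - y n + z n"]) blast
qed

lemma J_mem_closure_range:
  assumes comm: "\<And>f. J (A f) = A (J f)" and m: "m \<in> closure (range A)"
  shows "J m \<in> closure (range A)"
proof -
  have "J ` closure (range A) \<subseteq> closure (range A)"
  proof (rule image_closure_subset)
    show "continuous_on (closure (range A)) J"
      by (intro bounded_linear.continuous_on[OF selfadjoint_bounded_linear[OF J]]
          continuous_on_id)
    show "J ` range A \<subseteq> closure (range A)"
      using comm closure_subset by fastforce
  qed simp
  then show ?thesis using m by blast
qed

text \<open>Put \<open>Y m = X m - m + J X J m\<close> on \<open>M\<close>; the operator equation says \<open>Y = 0\<close>. If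
  \<open>S Y S = 0\<close>, then \<open>Y m\<close> is orthogonal to the dense set \<open>R(S\<^sup>2)\<close>, first for
  \<open>m\<close> in that set and then, by the symmetry of \<open>Y\<close>, for all \<open>m\<close>.

  Conversely, \<open>Y = 0\<close> gives \<open>S Y S = 0\<close> on the range of \<open>S\<close>, as \<open>S\<^sup>2\<close> maps into \<open>M\<close>. That also
  \<open>S\<close> maps into \<open>M\<close> would take an orthogonal decomposition of the space; instead, \<open>E = S Y S\<close> is
  symmetric and vanishes on the range of \<open>S\<close>, so its own range, which is contained in that of \<open>S\<close>,
  is orthogonal to itself.\<close>

lemma compressed_eq_0_iff:
  assumes S: "selfadjoint S" and comm: "\<And>f. J (S f) = S (J f)"
    and M: "M = closure (range (\<lambda>f. S (S f)))"
    and X: "nonneg_selfadjoint_contraction_in M X"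
    and E_def: "\<And>f. E f = S (X (S f) - S f + J (X (J (S f))))"
    and E_sym: "\<And>f g. cinner (E f) g = cinner f (E g)"
  shows "(\<forall>f. E f = 0) \<longleftrightarrow> (\<forall>f\<in>M. X f = J (J f - X (J f)))"
proof -
  define Y where "Y m = X m - m + J (X (J m))" for m
  have E: "E f = S (Y (S f))" for f by (simp add: E_def Y_def)
  note S_sym = selfadjoint_sym[OF S]
  have Y_iff: "Y m = 0 \<longleftrightarrow> X m = J (J m - X (J m))" for m
    by (auto simp: Y_def J_linear algebra_simps)
  have SS: "selfadjoint (\<lambda>f. S (S f))"
  proof -
    obtain c where c: "\<And>f. norm (S (S f)) \<le> norm f * c"
      using bounded_linear.bounded[OF bounded_linear_compose[OF selfadjoint_bounded_linear[OF S]
          selfadjoint_bounded_linear[OF S]]] by blast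
    then show ?thesis by (intro selfadjointI[of _ c]) (auto simp: S_sym mult.commute)
  qed
  have SS_M: "S (S f) \<in> M" for f unfolding M using closure_subset by fast
  have J_M: "J m \<in> M" if "m \<in> M" for m
    using J_mem_closure_range[of "\<lambda>f. S (S f)"] that comm unfolding M by simp
  have X_M: "X m \<in> M" if "m \<in> M" for m
    using X that by (auto simp: nonneg_selfadjoint_contraction_in_def)
  have Y_M: "Y m \<in> M" if "m \<in> M" for m
    using diff_add_mem_closure_range[OF SS] that X_M J_M unfolding Y_def M[symmetric] by blast
  have Y_sym: "cinner (Y m) n = cinner m (Y n)" if "m \<in> M" "n \<in> M" for m n
    using X that J_M
    by (simp add: Y_def cinner_add_left cinner_add_right cinner.diff_left cinner.diff_right cinner_J
        nonneg_selfadjoint_contraction_in_def)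
  have Y_0: "Y m = 0" if "m \<in> M" "\<And>g. cinner (Y m) (S (S g)) = 0" for m
    by (rule orthogonal_closure_eq_0[of _ "range (\<lambda>f. S (S f))"])
      (use Y_M[OF that(1)] that(2) in \<open>auto simp: M\<close>)
  show ?thesis
    unfolding Y_iff[symmetric]
  proof
    assume E0: "\<forall>f. E f = 0"
    have range: "Y (S (S h)) = 0" for h
    proof (rule Y_0[OF SS_M])
      have "S (Y (S (S h))) = 0" using E0 E by simp
      then show "cinner (Y (S (S h))) (S (S g)) = 0" for g
        by (simp add: S_sym[symmetric] selfadjoint_linear[OF S] cinner.zero_left)
    qed
    show "\<forall>m\<in>M. Y m = 0"
      by (intro ballI Y_0) (simp_all add: Y_sym SS_M range cinner.zero_right)
  next
    assume Y: "\<forall>m\<in>M. Y m = 0"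
    have orth: "cinner (E f) (S g) = 0" for f g
      using Y SS_M by (simp add: E_sym E[of "S g"] selfadjoint_linear[OF S] cinner.zero_right)
    have "cinner (E f) (E f) = 0" for f
      using orth[of f "Y (S f)"] unfolding E[of f, symmetric] .
    then show "\<forall>f. E f = 0" by (simp add: cinner_self)
  qed
qed

end

section \<open>The associated operator and its extensions\<close>

lemma graph_representation_mem:
  assumes "graph_representation H1 H2 L M K" and "x \<in> M"
  shows "x \<in> H1" "K x \<in> H2"
  using assms by (auto simp: graph_representation_def)

lemma associated_operatorE:
  assumes "associated_operator J Lp Lm D T0"
  obtains Mp Mm Kp Km where
    "graph_representation (H_plus J) (H_minus J) Lp Mp Kp"
    "graph_representation (H_minus J) (H_plus J) Lm Mm Km"
    "D = {x + y | x y. x \<in> Mp \<and> y \<in> Mm}"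
    "\<And>f. f \<in> D \<Longrightarrow> T0 f = Kp (P_plus J f) + Km (P_minus J f)"
  using assms unfolding associated_operator_def
  by (elim exE conjE) (rule that, assumption+, erule (1) bspec)

lemma graph_representation_linear:
  assumes "graph_representation H1 H2 L M K"
  shows "0 \<in> M" "K 0 = 0" "x \<in> M \<Longrightarrow> - x \<in> M" "x \<in> M \<Longrightarrow> K (- x) = - K x"
proof -
  have sub: "complex_vector.subspace M" and lin: "clinear_on M K"
    using assms by (auto simp: graph_representation_def closed_csubspace_def)
  have sc: "\<And>c x. x \<in> M \<Longrightarrow> K (c *\<^sub>C x) = c *\<^sub>C K x" using lin by (simp add: clinear_on_def)
  show 0: "0 \<in> M" using sub by (rule complex_vector.subspace_0)
  show "K 0 = 0" using sc[OF 0, of 0] by simp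
  show "x \<in> M \<Longrightarrow> - x \<in> M" using sub by (rule complex_vector.subspace_neg)
  show "x \<in> M \<Longrightarrow> K (- x) = - K x" using sc[of x "-1"] by simp
qed

context krein_space
begin

lemma associated_operator_anticommutes:
  assumes "associated_operator J Lp Lm D T0" and "f \<in> D"
  shows "J f \<in> D" "T0 (J f) = - J (T0 f)"
proof -
  from assms(1) obtain Mp Mm Kp Km where
    gp: "graph_representation (H_plus J) (H_minus J) Lp Mp Kp" and
    gm: "graph_representation (H_minus J) (H_plus J) Lm Mm Km" and
    D: "D = {x + y | x y. x \<in> Mp \<and> y \<in> Mm}" and
    T0: "\<And>f. f \<in> D \<Longrightarrow> T0 f = Kp (P_plus J f) + Km (P_minus J f)"
    by (rule associated_operatorE) blast
  from \<open>f \<in> D\<close> obtain x y where f: "f = x + y" and x: "x \<in> Mp" and y: "y \<in> Mm"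
    by (auto simp: D)
  have J: "J x = x" "J y = - y" "J (Kp x) = - Kp x" "J (Km y) = Km y"
    using graph_representation_mem[OF gp x] graph_representation_mem[OF gm y]
    by (simp_all add: mem_H_plus mem_H_minus)
  have my: "- y \<in> Mm" using graph_representation_linear(3)[OF gm y] .
  have Jf: "J f = x + - y" by (simp add: f J_linear J)
  show JfD: "J f \<in> D" unfolding Jf D using x my by blast
  have "T0 (J f) = Kp x - Km y"
    using T0[OF JfD] P_plus_split[of x "- y"] P_minus_split[of x "- y"]
      graph_representation_linear(4)[OF gm y]
    unfolding Jf by (simp add: J J_linear)
  also have "\<dots> = - J (Kp x + Km y)" by (simp add: J_linear J)
  also have "Kp x + Km y = T0 f"
    using T0[OF \<open>f \<in> D\<close>] by (simp add: f P_plus_split P_minus_split J)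
  finally show "T0 (J f) = - J (T0 f)" .
qed

lemma associated_operator_graphs:
  assumes assoc: "associated_operator J Lp Lm D T0"
  shows "Lp = (\<lambda>f. f + T0 f) ` (D \<inter> H_plus J)" "Lm = (\<lambda>f. f + T0 f) ` (D \<inter> H_minus J)"
proof -
  from assoc obtain Mp Mm Kp Km where
    gp: "graph_representation (H_plus J) (H_minus J) Lp Mp Kp" and
    gm: "graph_representation (H_minus J) (H_plus J) Lm Mm Km" and
    D: "D = {x + y | x y. x \<in> Mp \<and> y \<in> Mm}" and
    T0: "\<And>f. f \<in> D \<Longrightarrow> T0 f = Kp (P_plus J f) + Km (P_minus J f)"
    by (rule associated_operatorE) blast
  have Mp: "\<And>x. x \<in> Mp \<Longrightarrow> J x = x" and Mm: "\<And>y. y \<in> Mm \<Longrightarrow> J y = - y"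
    using graph_representation_mem(1)[OF gp] graph_representation_mem(1)[OF gm]
    by (simp_all add: mem_H_plus mem_H_minus)
  note lin = graph_representation_linear[OF gp] graph_representation_linear[OF gm]
  have D_plus: "D \<inter> H_plus J = Mp"
  proof (intro equalityI subsetI)
    fix f assume "f \<in> D \<inter> H_plus J"
    then obtain x y where f: "f = x + y" "x \<in> Mp" "y \<in> Mm" "J f = f"
      by (auto simp: D mem_H_plus)
    have "P_plus J f = x" using f Mp Mm by (simp add: P_plus_split)
    moreover have "P_plus J f = f" using P_plus_split[of f 0] f by (simp add: J_linear)
    ultimately show "f \<in> Mp" using f by simp
  next
    fix x assume x: "x \<in> Mp"
    then have "x + 0 \<in> D" using lin(5) unfolding D by blast
    with x Mp show "x \<in> D \<inter> H_plus J" by (simp add: mem_H_plus)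
  qed
  have D_minus: "D \<inter> H_minus J = Mm"
  proof (intro equalityI subsetI)
    fix f assume "f \<in> D \<inter> H_minus J"
    then obtain x y where f: "f = x + y" "x \<in> Mp" "y \<in> Mm" "J f = - f"
      by (auto simp: D mem_H_minus)
    have "P_minus J f = y" using f Mp Mm by (simp add: P_minus_split)
    moreover have "P_minus J f = f" using P_minus_split[of 0 f] f by (simp add: J_linear)
    ultimately show "f \<in> Mm" using f by simp
  next
    fix y assume y: "y \<in> Mm"
    then have "0 + y \<in> D" using lin(1) unfolding D by blast
    with y Mm show "y \<in> D \<inter> H_minus J" by (simp add: mem_H_minus)
  qed
  have "T0 x = Kp x" if "x \<in> Mp" for x
    using T0[of x] that Mp D_plus P_plus_split[of x 0] P_minus_split[of x 0] lin
    by (auto simp: J_linear)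
  then show "Lp = (\<lambda>f. f + T0 f) ` (D \<inter> H_plus J)"
    using gp by (simp add: D_plus graph_representation_def)
  have "T0 y = Km y" if "y \<in> Mm" for y
    using T0[of y] that Mm D_minus P_plus_split[of 0 y] P_minus_split[of 0 y] lin
    by (auto simp: J_linear)
  then show "Lm = (\<lambda>f. f + T0 f) ` (D \<inter> H_minus J)"
    using gm by (simp add: D_minus graph_representation_def)
qed

lemma associated_operator_UNIV_strong_contraction:
  assumes "associated_operator J Lp Lm UNIV T"
  shows "strong_contraction_on UNIV T"
proof -
  from assms obtain Mp Mm Kp Km where
    gp: "graph_representation (H_plus J) (H_minus J) Lp Mp Kp" and
    gm: "graph_representation (H_minus J) (H_plus J) Lm Mm Km" and
    D: "UNIV = {x + y | x y. x \<in> Mp \<and> y \<in> Mm}" and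
    T: "\<And>f. f \<in> UNIV \<Longrightarrow> T f = Kp (P_plus J f) + Km (P_minus J f)"
    by (rule associated_operatorE) blast
  have "norm (T f) < norm f" if nz: "f \<noteq> 0" for f
  proof -
    obtain x y where f: "f = x + y" and x: "x \<in> Mp" and y: "y \<in> Mm"
      using D by blast
    have J: "J x = x" "J y = - y" "J (Kp x) = - Kp x" "J (Km y) = Km y"
      using graph_representation_mem[OF gp x] graph_representation_mem[OF gm y]
      by (simp_all add: mem_H_plus mem_H_minus)
    have strong: "x \<noteq> 0 \<Longrightarrow> norm (Kp x) < norm x" "y \<noteq> 0 \<Longrightarrow> norm (Km y) < norm y"
      using x y gp gm by (auto simp: graph_representation_def strong_contraction_on_def)
    have zero: "Kp 0 = 0" "Km 0 = 0"
      using graph_representation_linear(2) gp gm by blast+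
    have "T f = Km y + Kp x"
      by (simp add: T f P_plus_split P_minus_split J)
    then have "(norm (T f))\<^sup>2 = (norm (Kp x))\<^sup>2 + (norm (Km y))\<^sup>2"
      using norm_add_H_plus_H_minus[of "Km y" "Kp x"] J by simp
    also have "\<dots> < (norm x)\<^sup>2 + (norm y)\<^sup>2"
    proof (cases "x = 0")
      case True
      with nz f have "y \<noteq> 0" by simp
      with strong(2) show ?thesis by (simp add: True zero power_strict_mono)
    next
      case False
      then have "(norm (Kp x))\<^sup>2 < (norm x)\<^sup>2" using strong(1) by (simp add: power_strict_mono)
      moreover have "(norm (Km y))\<^sup>2 \<le> (norm y)\<^sup>2"
        using strong(2) zero by (cases "y = 0") (auto intro: power_mono)
      ultimately show ?thesis by (rule add_less_le_mono)
    qed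
    also have "\<dots> = (norm f)\<^sup>2" using J by (simp add: f norm_add_H_plus_H_minus)
    finally show ?thesis by (rule power2_less_imp_less) simp
  qed
  then show ?thesis by (simp add: strong_contraction_on_def)
qed

lemma associated_operator_UNIV:
  assumes T: "selfadjoint T" and anti: "anticommutes T" and strong: "strong_contraction_on UNIV T"
  shows "associated_operator J ((\<lambda>f. f + T f) ` H_plus J) ((\<lambda>f. f + T f) ` H_minus J) UNIV T"
proof -
  have lin: "clinear_on N T" for N
    using T by (simp add: selfadjoint_def clinear_on_def)
  have "graph_representation (H_plus J) (H_minus J) ((\<lambda>f. f + T f) ` H_plus J) (H_plus J) T"
    using lin anti strong closed_csubspace_H_plus
    by (auto simp: graph_representation_def strong_contraction_on_def anticommutes_def
        mem_H_plus mem_H_minus)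
  moreover have
    "graph_representation (H_minus J) (H_plus J) ((\<lambda>f. f + T f) ` H_minus J) (H_minus J) T"
    using lin anti strong closed_csubspace_H_minus
    by (auto simp: graph_representation_def strong_contraction_on_def anticommutes_def
        mem_H_plus mem_H_minus selfadjoint_linear[OF T])
  moreover have "UNIV = {x + y | x y. x \<in> H_plus J \<and> y \<in> H_minus J}"
  proof -
    have "f \<in> {x + y | x y. x \<in> H_plus J \<and> y \<in> H_minus J}" for f
      using P_plus_add_P_minus[of f, symmetric] by (auto simp: H_plus_def H_minus_def)
    then show ?thesis by blast
  qed
  moreover have "T f = T (P_plus J f) + T (P_minus J f)" for f
    by (simp add: selfadjoint_linear(1)[OF T, symmetric] P_plus_add_P_minus)
  ultimately show ?thesis unfolding associated_operator_def by blast
qed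

text \<open>\<open>T \<mapsto> -J T J\<close> is an order-reversing involution of the operator interval, so it interchanges
  the end points.\<close>

lemma extension_reflect:
  assumes assoc: "associated_operator J Lp Lm D T0"
    and T: "selfadjoint_contractive_extension D T0 T"
  shows "selfadjoint_contractive_extension D T0 (\<lambda>f. - J (T (J f)))"
proof -
  have sa: "selfadjoint T" and contr: "\<And>f. norm (T f) \<le> norm f"
    and ext: "\<And>f. f \<in> D \<Longrightarrow> T f = T0 f"
    using T by (auto simp: selfadjoint_contractive_extension_def contraction_def)
  have bd: "norm (- J (T (J f))) \<le> norm f" for f using contr[of "J f"] by simp
  moreover have "selfadjoint (\<lambda>f. - J (T (J f)))"
    by (rule selfadjointI[of _ 1])
      (use bd in \<open>auto simp: cinner.minus_left cinner.minus_right cinner_J selfadjoint_sym[OF sa]\<close>)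
  moreover have "- J (T (J f)) = T0 f" if "f \<in> D" for f
    using associated_operator_anticommutes[OF assoc that] ext by (simp add: J_linear)
  ultimately show ?thesis
    by (simp add: selfadjoint_contractive_extension_def contraction_def)
qed

lemma soft_extension_eq_reflected_hard_extension:
  assumes assoc: "associated_operator J Lp Lm D T0"
    and hard: "hard_extension D T0 Tmu" and soft: "soft_extension D T0 TM"
  shows "TM f = - J (Tmu (J f))"
proof -
  let ?R = "\<lambda>f. - J (Tmu (J f))"
  have ext: "selfadjoint_contractive_extension D T0 Tmu"
    "selfadjoint_contractive_extension D T0 TM"
    using hard soft by (simp_all add: hard_extension_def soft_extension_def)
  note refl = extension_reflect[OF assoc ext(1)] extension_reflect[OF assoc ext(2)]
  have "op_le Tmu (\<lambda>f. - J (TM (J f)))"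
    using hard refl(2) by (simp add: hard_extension_def)
  then have "Re (cinner (Tmu (J h)) (J h)) \<le> - Re (cinner (TM h) h)" for h
    unfolding op_le_def by (auto simp: cinner.minus_left cinner_J dest: spec[of _ "J h"])
  then have "op_le TM ?R"
    by (simp add: op_le_def cinner.minus_left cinner_J le_minus_iff[of "Re (cinner (Tmu _) _)"])
  moreover have "op_le ?R TM" using soft refl(1) by (simp add: soft_extension_def)
  ultimately have "TM = ?R"
    using ext(2) refl(1) by (intro op_le_antisym) (auto simp: selfadjoint_contractive_extension_def)
  then show ?thesis by (rule fun_cong)
qed

text \<open>With \<open>A = T\<^sub>M - T\<^sub>\<mu>\<close> and \<open>S = A\<^sup>1\<^sup>/\<^sup>2\<close>, both commuting with \<open>J\<close>, the relation
  \<open>T\<^sub>M = -J T\<^sub>\<mu> J\<close> turns \<open>T + J T J\<close> into \<open>S (X - I + J X J) S\<close>.\<close>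

lemma anticommutes_iff_operator_equation:
  assumes S: "is_positive_sqrt (\<lambda>g. TM g - Tmu g) S" and comm: "\<And>f. J (S f) = S (J f)"
    and reflect: "\<And>f. TM f = - J (Tmu (J f))"
    and M: "M = closure (range (\<lambda>f. TM f - Tmu f))"
    and T: "selfadjoint T" and X: "nonneg_selfadjoint_contraction_in M X"
    and T_eq: "\<And>f. T f = Tmu f + S (X (S f))"
  shows "anticommutes T \<longleftrightarrow> (\<forall>f\<in>M. X f = J (J f - X (J f)))"
proof -
  define E where "E f = T f + J (T (J f))" for f
  have sa: "selfadjoint S" and SS: "\<And>f. S (S f) = TM f - Tmu f"
    using S by (auto simp: is_positive_sqrt_def fun_eq_iff)
  have "(\<forall>f. E f = 0) \<longleftrightarrow> (\<forall>f\<in>M. X f = J (J f - X (J f)))"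
  proof (rule compressed_eq_0_iff[OF sa comm])
    show "M = closure (range (\<lambda>f. S (S f)))" by (simp add: M SS)
    show "E f = S (X (S f) - S f + J (X (J (S f))))" for f
    proof -
      have "S (S f) = - Tmu f - J (Tmu (J f))" by (simp add: SS reflect)
      then show ?thesis
        by (simp add: E_def T_eq J_linear selfadjoint_linear[OF sa] comm)
    qed
    show "cinner (E f) g = cinner f (E g)" for f g
      by (simp add: E_def cinner_add_left cinner_add_right cinner_J selfadjoint_sym[OF T])
  qed (rule X)
  moreover have "E f = 0 \<longleftrightarrow> J (T (J f)) = - T (J (J f))" for f
    by (simp add: E_def eq_neg_iff_add_eq_0 add.commute)
  then have "(\<forall>f. E f = 0) \<longleftrightarrow> anticommutes T"
    unfolding anticommutes_def by (metis JJ)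
  ultimately show ?thesis by simp
qed

end

section \<open>Dual maximal extensions\<close>

theorem theorem2p5:
  fixes J T0 Tmu TM T X :: "'a::chilbert_space \<Rightarrow> 'a"
    and Lp Lm D M :: "'a set"
  assumes "fundamental_symmetry J"
    and "dual_definite J Lp Lm"
    and "associated_operator J Lp Lm D T0"
    and "hard_extension D T0 Tmu"
    and "soft_extension D T0 TM"
    and "M = closure (range (\<lambda>f. TM f - Tmu f))"
    and "selfadjoint_contractive_extension D T0 T"
    and "nonneg_selfadjoint_contraction_in M X"
    and "\<And>f. T f = Tmu f + op_sqrt (\<lambda>g. TM g - Tmu g) (X (op_sqrt (\<lambda>g. TM g - Tmu g) f))"
  shows
    "(closure {f + g | f g. f \<in> Lp \<and> g \<in> Lm} = UNIV \<longrightarrow>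
        (dual_maximal J ((\<lambda>f. f + T f) ` H_plus J) ((\<lambda>f. f + T f) ` H_minus J)
          \<longleftrightarrow> (\<forall>f\<in>M. X f = J (J f - X (J f)))))
     \<and>
     ((dual_maximal J ((\<lambda>f. f + T f) ` H_plus J) ((\<lambda>f. f + T f) ` H_minus J) \<and>
       associated_operator J ((\<lambda>f. f + T f) ` H_plus J) ((\<lambda>f. f + T f) ` H_minus J) UNIV T)
          \<longleftrightarrow> ((\<forall>f\<in>M. X f = J (J f - X (J f))) \<and> strong_contraction_on UNIV T))"
proof -
  let ?Lp = "(\<lambda>f. f + T f) ` H_plus J" and ?Lm = "(\<lambda>f. f + T f) ` H_minus J"
  interpret krein_space J
    using assms(1) by unfold_locales (auto simp: fundamental_symmetry_def)
  have T: "selfadjoint T" "contraction T" and ext: "\<And>f. f \<in> D \<Longrightarrow> T f = T0 f"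
    using assms(7) by (auto simp: selfadjoint_contractive_extension_def)
  have "selfadjoint Tmu" "selfadjoint TM" "op_le Tmu TM"
    using assms(4,5)
    by (auto simp: hard_extension_def soft_extension_def selfadjoint_contractive_extension_def)
  then have A: "selfadjoint (\<lambda>g. TM g - Tmu g)" "op_le (\<lambda>_. 0) (\<lambda>g. TM g - Tmu g)"
    by (auto simp: selfadjoint_diff op_le_def cinner.diff_left cinner.zero_left)
  note reflect = soft_extension_eq_reflected_hard_extension[OF assms(3-5)]
  note sqrt = op_sqrt_is_positive_sqrt[OF A]
  have "J (op_sqrt (\<lambda>g. TM g - Tmu g) f) = op_sqrt (\<lambda>g. TM g - Tmu g) (J f)" for f
    by (rule positive_sqrt_commute[OF A sqrt selfadjoint_bounded_linear[OF J]])
      (simp add: reflect J_linear)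
  with sqrt have X_iff: "anticommutes T \<longleftrightarrow> (\<forall>f\<in>M. X f = J (J f - X (J f)))"
    using reflect assms(6) T(1) assms(8,9) by (rule anticommutes_iff_operator_equation)
  have "dual_maximal J ?Lp ?Lm \<longleftrightarrow> anticommutes T"
    if dense: "closure {f + g | f g. f \<in> Lp \<and> g \<in> Lm} = UNIV"
  proof -
    have Lp: "Lp = (\<lambda>f. f + T f) ` (D \<inter> H_plus J)" and Lm: "Lm = (\<lambda>f. f + T f) ` (D \<inter> H_minus J)"
      using associated_operator_graphs[OF assms(3)] ext by simp_all
    have sum_eq: "{f + g | f g. f \<in> Lp \<and> g \<in> Lm}
        = {(g + T g) + (h + T h) | g h. g \<in> D \<inter> H_plus J \<and> h \<in> D \<inter> H_minus J}"
      unfolding Lp Lm by blast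
    have JT: "J (T f) = - T (J f)" if "f \<in> D" for f
      using associated_operator_anticommutes[OF assms(3) that] ext that by simp
    show ?thesis
    proof
      assume "dual_maximal J ?Lp ?Lm"
      then have dual: "krein J (f + T f) (h + T h) = 0" if "J f = f" "J h = - h" for f h
        using that by (auto simp: dual_maximal_def dual_definite_def mem_H_plus mem_H_minus)
      show "anticommutes T"
      proof (rule dual_graphs_anticommute[OF T(1) _ _ dual dense[unfolded sum_eq]])
        show "J g = g \<and> J (T g) = - T g" if "g \<in> D \<inter> H_plus J" for g
          using that JT by (simp add: mem_H_plus)
        show "J h = - h \<and> J (T h) = T h" if "h \<in> D \<inter> H_minus J" for h
          using that JT by (simp add: mem_H_minus selfadjoint_linear[OF T(1)])
      qed
    next
      assume anti: "anticommutes T"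
      have "{f + g | f g. f \<in> Lp \<and> g \<in> Lm} \<subseteq> range (\<lambda>f. f + T f)"
      proof
        fix v assume "v \<in> {f + g | f g. f \<in> Lp \<and> g \<in> Lm}"
        then obtain g h where "v = (g + T g) + (h + T h)" unfolding sum_eq by blast
        then have "v = (g + h) + T (g + h)" by (simp add: selfadjoint_linear[OF T(1)])
        then show "v \<in> range (\<lambda>f. f + T f)" by blast
      qed
      from closure_mono[OF this] dense have "closure (range (\<lambda>f. f + T f)) = UNIV" by auto
      with T anti show "dual_maximal J ?Lp ?Lm"
        by (intro graph_dual_maximal anticommutes_strong_contraction)
    qed
  qed
  moreover have "(dual_maximal J ?Lp ?Lm \<and> associated_operator J ?Lp ?Lm UNIV T)
      \<longleftrightarrow> (anticommutes T \<and> strong_contraction_on UNIV T)"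
  proof
    assume "dual_maximal J ?Lp ?Lm \<and> associated_operator J ?Lp ?Lm UNIV T"
    then have assoc: "associated_operator J ?Lp ?Lm UNIV T" by simp
    show "anticommutes T \<and> strong_contraction_on UNIV T"
      using associated_operator_anticommutes(2)[OF assoc]
        associated_operator_UNIV_strong_contraction[OF assoc]
      by (simp add: anticommutes_def)
  next
    assume H: "anticommutes T \<and> strong_contraction_on UNIV T"
    then have "strong_contraction_on N T" for N by (simp add: strong_contraction_on_def)
    with H T(1) show "dual_maximal J ?Lp ?Lm \<and> associated_operator J ?Lp ?Lm UNIV T"
      by (intro conjI graph_dual_maximal associated_operator_UNIV) auto
  qed
  ultimately show ?thesis unfolding X_iff by blast
qed

end
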